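(* Let $\mathbb{K}$ be an algebraically closed field. Let $f$ be a concise irreducible form of degree $d>1$ in $n+1$ variables over $\mathbb{K}$ such that $V(f)\subset\mathbb{P}^n$ is covered by $k$-planes, and let $r\in\mathbb{N}$. (1) If $\mathbf{F}_k(X_{r,d})$ is one-split, then $\mathbf{pr}(f)\neq r$. (2) If $r$ is even, $k>n-r$, and $$\mathbf{F}_k(X_{r,d}),\ \mathbf{F}_{k-d}(X_{r-2,d}),\ \ldots,\ \mathbf{F}_{k-\frac{d(r-4)}{2}}(X_{4,d})$$ are all two-split (that is, $\mathbf{F}_{k-td}(X_{r-2t,d})$ is two-split for $0\le t\le \frac{r-4}{2}$), then $\mathbf{pr}(f)\neq r$.
   Context: $\mathbf{pr}(f)$, the product rank (Chow rank) of a degree $d$ form $f$, is the smallest number $r$ such that $f=\boldsymbol{\ell}_1+\dots+\boldsymbol{\ell}_r$ where each $\boldsymbol{\ell}_i$ is a product of $d$ linear forms. A form in $n+1$ variables is concise if it cannot be written as a form in fewer variables after a linear change of coordinates. "$V(f)$ is covered by $k$-planes" means every point of $V(f)$ lies in a $k$-dimensional projective linear subspace contained in $V(f)$. $X_{r,d}=V\left(\sum_{i=1}^r\prod_{j=1}^d x_{ij}\right)\subset\mathbb{P}^{rd-1}$, where $x_{ij}$ ($1\le i\le r$, $1\le j\le d$) are the homogeneous coordinates on $\mathbb{P}^{rd-1}$. $\mathbf{F}_k(X)$ is the Fano scheme parametrizing $k$-planes contained in $X$. For an integer $\lambda\geq 1$, a $k$-plane $L\subset X_{r,d}$ admits a $\lambda$-splitting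 if there exist $1\leq a_1<\dots<a_\lambda\leq r$ such that $L\subset V\left(\sum_{i=1}^\lambda\prod_{j=1}^d x_{a_ij}\right)$. $\mathbf{F}_k(X_{r,d})$ is $m$-split if every $k$-plane contained in $X_{r,d}$ admits a $\lambda$-splitting for some $\lambda\leq m$ (one-split: $m=1$; two-split: $m=2$). *)

theory Defs
  imports
    "HOL-Computational_Algebra.Computational_Algebra"
    "HOL-Library.Poly_Mapping"
    "HOL-Library.Function_Algebras"
begin

section \<open>Polynomials and forms\<close>

text \<open>
  Multivariate polynomials are finitely supported maps from monomials (finitely supported
  exponent vectors) to coefficients, with the ring structure of \<^theory>\<open>HOL-Library.Poly_Mapping\<close>.
  The variables are indexed by the type \<open>'i\<close>; the polynomial ring in the variables
  \<open>x\<^sub>i\<close> with \<open>i \<in> I\<close> is the subring of the polynomials \<open>f\<close> with \<open>vars f \<subseteq> I\<close>. The factors of a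
  nonzero polynomial over a field involve only variables of that polynomial, so
  \<^const>\<open>irreducible\<close> means the same in this subring as in the whole type.
\<close>

type_synonym ('i, 'a) mpoly = "('i \<Rightarrow>\<^sub>0 nat) \<Rightarrow>\<^sub>0 'a"

definition Var :: "'i \<Rightarrow> ('i, 'a::comm_semiring_1) mpoly" where
  "Var i = Poly_Mapping.single (Poly_Mapping.single i 1) 1"

definition Const :: "'a::comm_semiring_1 \<Rightarrow> ('i, 'a) mpoly" where
  "Const c = Poly_Mapping.single 0 c"

definition vars :: "('i, 'a::comm_semiring_1) mpoly \<Rightarrow> 'i set" where
  "vars f = (\<Union>m\<in>Poly_Mapping.keys f. Poly_Mapping.keys m)"

definition mdeg :: "('i \<Rightarrow>\<^sub>0 nat) \<Rightarrow> nat" where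
  "mdeg m = (\<Sum>i\<in>Poly_Mapping.keys m. Poly_Mapping.lookup m i)"

definition poly_eval :: "('i, 'a::comm_semiring_1) mpoly \<Rightarrow> ('i \<Rightarrow> 'a) \<Rightarrow> 'a" where
  "poly_eval f v = (\<Sum>m\<in>Poly_Mapping.keys f. Poly_Mapping.lookup f m *
                 (\<Prod>i\<in>Poly_Mapping.keys m. v i ^ Poly_Mapping.lookup m i))"

text \<open>Forms of degree \<open>d\<close> in the variables \<open>I\<close>; as usual these form a vector space, so \<open>0\<close> is
  included.\<close>

definition is_form :: "'i set \<Rightarrow> nat \<Rightarrow> ('i, 'a::comm_semiring_1) mpoly \<Rightarrow> bool" where
  "is_form I d f \<longleftrightarrow> vars f \<subseteq> I \<and> (\<forall>m\<in>Poly_Mapping.keys f. mdeg m = d)"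

section \<open>Product rank and conciseness\<close>

text \<open>For \<open>d > 0\<close> every form is a sum of products of \<open>d\<close> linear forms (its terms are such
  products), so the minimum below is taken over a nonempty set.\<close>

definition product_rank :: "'i set \<Rightarrow> nat \<Rightarrow> ('i, 'a::comm_semiring_1) mpoly \<Rightarrow> nat" where
  "product_rank I d f =
     (LEAST r. \<exists>l :: nat \<Rightarrow> nat \<Rightarrow> ('i, 'a) mpoly.
        (\<forall>i\<in>{1..r}. \<forall>j\<in>{1..d}. is_form I 1 (l i j)) \<and>
        f = (\<Sum>i\<in>{1..r}. \<Prod>j\<in>{1..d}. l i j))"

text \<open>Only the entries of \<open>A\<close> and \<open>B\<close> with both indices in \<open>I\<close> matter in what follows.\<close>

definition inverse_matrices ::
    "'i set \<Rightarrow> ('i \<Rightarrow> 'i \<Rightarrow> 'a::comm_semiring_1) \<Rightarrow> ('i \<Rightarrow> 'i \<Rightarrow> 'a) \<Rightarrow> bool" where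
  "inverse_matrices I A B \<longleftrightarrow>
     (\<forall>i\<in>I. \<forall>j\<in>I. (\<Sum>l\<in>I. A i l * B l j) = (if i = j then 1 else 0)) \<and>
     (\<forall>i\<in>I. \<forall>j\<in>I. (\<Sum>l\<in>I. B i l * A l j) = (if i = j then 1 else 0))"

text \<open>The substitution \<open>x\<^sub>i \<mapsto> \<Sum>\<^sub>j A\<^sub>i\<^sub>j x\<^sub>j\<close>.\<close>

definition linear_subst ::
    "'i set \<Rightarrow> ('i \<Rightarrow> 'i \<Rightarrow> 'a::comm_semiring_1) \<Rightarrow> ('i, 'a) mpoly \<Rightarrow> ('i, 'a) mpoly" where
  "linear_subst I A f =
     (\<Sum>m\<in>Poly_Mapping.keys f. Const (Poly_Mapping.lookup f m) *
        (\<Prod>i\<in>Poly_Mapping.keys m. (\<Sum>j\<in>I. Const (A i j) * Var j) ^ Poly_Mapping.lookup m i))"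

definition concise :: "'i set \<Rightarrow> ('i, 'a::comm_semiring_1) mpoly \<Rightarrow> bool" where
  "concise I f \<longleftrightarrow>
     \<not> (\<exists>A B. inverse_matrices I A B \<and> vars (linear_subst I A f) \<subset> I)"

section \<open>Projective spaces, linear subspaces and hypersurfaces\<close>

definition fscale :: "'a::field \<Rightarrow> ('i \<Rightarrow> 'a) \<Rightarrow> 'i \<Rightarrow> 'a" where
  "fscale c v = (\<lambda>i. c * v i)"

interpretation fun_space: vector_space "fscale :: 'a::field \<Rightarrow> ('i \<Rightarrow> 'a) \<Rightarrow> 'i \<Rightarrow> 'a"
  by unfold_locales (auto simp: fscale_def plus_fun_def fun_eq_iff algebra_simps)

text \<open>The affine space with coordinates indexed by \<open>I\<close>: coordinates outside \<open>I\<close> vanish.\<close>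

definition coord_space :: "'i set \<Rightarrow> ('i \<Rightarrow> 'a::field) set" where
  "coord_space I = {v. \<forall>i. i \<notin> I \<longrightarrow> v i = 0}"

text \<open>Points of a projective space are lines through the origin. For a linear subspace \<open>W\<close> of
  the coordinate space, \<open>projectivization W\<close> is the set of the points of \<open>\<P>(W)\<close>.\<close>

definition projectivization :: "('i \<Rightarrow> 'a::field) set \<Rightarrow> ('i \<Rightarrow> 'a) set set" where
  "projectivization W = {p. fun_space.subspace p \<and> fun_space.dim p = 1 \<and> p \<subseteq> W}"

definition proj_space :: "'i set \<Rightarrow> ('i \<Rightarrow> 'a::field) set set" where
  "proj_space I = projectivization (coord_space I)"

text \<open>Used only for homogeneous \<open>f\<close>, where vanishing does not depend on the representative.\<close>

definition proj_zeros :: "'i set \<Rightarrow> ('i, 'a::field) mpoly \<Rightarrow> ('i \<Rightarrow> 'a) set set" where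
  "proj_zeros I f = {p \<in> proj_space I. \<forall>v\<in>p. poly_eval f v = 0}"

text \<open>The dimension of a plane is an integer: the only \<open>(-1)\<close>-plane is the empty one, and there
  are no \<open>k\<close>-planes for \<open>k < -1\<close>.\<close>

definition is_plane :: "'i set \<Rightarrow> int \<Rightarrow> ('i \<Rightarrow> 'a::field) set set \<Rightarrow> bool" where
  "is_plane I k L \<longleftrightarrow>
     (\<exists>W. fun_space.subspace W \<and> W \<subseteq> coord_space I \<and> int (fun_space.dim W) = k + 1 \<and>
          L = projectivization W)"

text \<open>The set of closed points of the Fano scheme (over an algebraically closed field), i.e. the
  set of all \<open>k\<close>-planes contained in \<open>X\<close>.\<close>

definition fano :: "'i set \<Rightarrow> int \<Rightarrow> ('i \<Rightarrow> 'a::field) set set \<Rightarrow> ('i \<Rightarrow> 'a) set set set" where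
  "fano I k X = {L. is_plane I k L \<and> L \<subseteq> X}"

definition covered_by_planes :: "'i set \<Rightarrow> int \<Rightarrow> ('i \<Rightarrow> 'a::field) set set \<Rightarrow> bool" where
  "covered_by_planes I k X \<longleftrightarrow> (\<forall>p\<in>X. \<exists>L\<in>fano I k X. p \<in> L)"

section \<open>The hypersurfaces $X_{r,d}$ and splitting\<close>

definition X_index :: "nat \<Rightarrow> nat \<Rightarrow> (nat \<times> nat) set" where
  "X_index r d = {1..r} \<times> {1..d}"

text \<open>The coordinate \<open>x\<^sub>i\<^sub>j\<close> is \<open>Var (i, j)\<close>.\<close>

definition X_hyp :: "nat \<Rightarrow> nat \<Rightarrow> (nat \<times> nat \<Rightarrow> 'a::field) set set" where
  "X_hyp r d = proj_zeros (X_index r d) (\<Sum>i\<in>{1..r}. \<Prod>j\<in>{1..d}. Var (i, j))"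

definition admits_splitting ::
    "nat \<Rightarrow> nat \<Rightarrow> nat \<Rightarrow> (nat \<times> nat \<Rightarrow> 'a::field) set set \<Rightarrow> bool" where
  "admits_splitting r d s L \<longleftrightarrow>
     (\<exists>a :: nat \<Rightarrow> nat. strict_mono_on {1..s} a \<and> a ` {1..s} \<subseteq> {1..r} \<and>
        L \<subseteq> proj_zeros (X_index r d) (\<Sum>i\<in>{1..s}. \<Prod>j\<in>{1..d}. Var (a i, j)))"

text \<open>\<open>fano_split TYPE('a) m k r d\<close>: over the field \<open>'a\<close>, the Fano scheme of \<open>k\<close>-planes in
  $X_{r,d}$ is \<open>m\<close>-split.\<close>

definition fano_split :: "'a::field itself \<Rightarrow> nat \<Rightarrow> int \<Rightarrow> nat \<Rightarrow> nat \<Rightarrow> bool" where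
  "fano_split _ m k r d \<longleftrightarrow>
     (\<forall>L \<in> fano (X_index r d) k (X_hyp r d :: (nat \<times> nat \<Rightarrow> 'a) set set).
        \<exists>s. 1 \<le> s \<and> s \<le> m \<and> admits_splitting r d s L)"

end

theory Submission
  imports Defs
begin

text \<open>
  Write \<open>f\<close> as a sum of \<open>r = pr(f)\<close> products of linear forms \<open>l\<^sub>i\<^sub>j\<close>. As \<open>f\<close> is concise, the
  \<open>l\<^sub>i\<^sub>j\<close> have no common zero in $\mathbb{P}^n$, so they embed $V(f)$ and its
  \<open>k\<close>-planes linearly into $X_{r,d}$. If the \<open>k\<close>-planes of $X_{r,d}$ are
  \<open>m\<close>-split, then every zero of \<open>f\<close> is a zero of one of the partial sums \<open>g\<close> with at most \<open>m\<close> of the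
  \<open>r\<close> products. By irreducibility \<open>f\<close> divides one such \<open>g\<close>, and \<open>g\<close> is a scalar multiple of \<open>f\<close> by
  degree; minimality of \<open>r\<close> rules out \<open>g = 0\<close> and then forces \<open>r \<le> m\<close>. An irreducible form of degree \<open>> 1\<close> is not a
  product of linear forms, so \<open>r > 1\<close>; this leaves \<open>r = 2\<close> in part (2). There the \<open>k\<close>-planes have
  codimension at most one in $\mathbb{P}^n$, and \<open>f\<close> would have a linear factor.

  The divisibility step needs the Nullstellensatz for an irreducible form \<open>f\<close>. Let \<open>R\<close> be the polynomial
  ring and choose \<open>p\<close> with \<open>f(p) \<noteq> 0\<close>. Then \<open>f(x + T p) \<in> R[T]\<close> has a constant leading coefficient, and it is
  irreducible over the fraction field of \<open>R\<close>: its monic factors have coefficients in \<open>R\<close>, because divisibility in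
  \<open>R\<close> can be tested on the lines in a general direction. A polynomial \<open>g\<close> not divisible by \<open>f\<close> then gives a
  Bezout identity for \<open>f(x + T p)\<close> and \<open>g(x + T p)\<close>, and specializing \<open>x\<close> yields a zero of \<open>f\<close> that is
  not a zero of \<open>g\<close>.
\<close>

section \<open>Evaluation homomorphisms\<close>

definition mono_eval :: "('i \<Rightarrow> 'b::comm_semiring_1) \<Rightarrow> ('i \<Rightarrow>\<^sub>0 nat) \<Rightarrow> 'b" where
  "mono_eval s m = (\<Prod>i\<in>Poly_Mapping.keys m. s i ^ Poly_Mapping.lookup m i)"

lemma mono_eval_superset:
  assumes "finite S" "Poly_Mapping.keys m \<subseteq> S"
  shows "mono_eval s m = (\<Prod>i\<in>S. s i ^ Poly_Mapping.lookup m i)"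
  unfolding mono_eval_def
  by (rule prod.mono_neutral_left) (use assms in \<open>auto simp: in_keys_iff\<close>)

lemma mono_eval_0 [simp]: "mono_eval s 0 = 1"
  by (simp add: mono_eval_def)

lemma mono_eval_single [simp]: "mono_eval s (Poly_Mapping.single i k) = s i ^ k"
  by (simp add: mono_eval_def)

lemma mono_eval_add: "mono_eval s (m + m') = mono_eval s m * mono_eval s m'"
proof -
  let ?S = "Poly_Mapping.keys m \<union> Poly_Mapping.keys m'"
  have "mono_eval s (m + m') = (\<Prod>i\<in>?S. s i ^ Poly_Mapping.lookup (m + m') i)"
    by (rule mono_eval_superset) (auto dest: subsetD[OF keys_add])
  also have "\<dots> = mono_eval s m * mono_eval s m'"
    by (simp add: mono_eval_superset[of ?S] lookup_add power_add prod.distrib)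
  finally show ?thesis .
qed

lemma mpoly_eq_sum_single:
  fixes f :: "'i \<Rightarrow>\<^sub>0 'a::comm_monoid_add"
  shows "f = (\<Sum>m\<in>Poly_Mapping.keys f. Poly_Mapping.single m (Poly_Mapping.lookup f m))"
  by (rule poly_mapping_eqI)
    (auto simp: lookup_sum lookup_single when_def in_keys_iff sum.delta)

lemma mpoly_induct [case_names single add]:
  fixes f :: "('i, 'a::comm_semiring_1) mpoly"
  assumes "\<And>m c. P (Poly_Mapping.single m c)" "\<And>f g. P f \<Longrightarrow> P g \<Longrightarrow> P (f + g)"
  shows "P f"
proof -
  have "P (\<Sum>m\<in>A. Poly_Mapping.single m (Poly_Mapping.lookup f m))" if "finite A" for A
    using that assms(1)[of 0 0] by (induction A rule: finite_induct) (auto intro: assms)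
  then show ?thesis by (subst mpoly_eq_sum_single) simp
qed

text \<open>Evaluation, restriction to lines, linear substitution and passage to the fraction field
  are all instances, so compatibility with sums, products and \<open>map_poly\<close> is proved
  once.\<close>

locale ring_hom_0 =
  fixes h :: "'a::comm_semiring_1 \<Rightarrow> 'b::comm_semiring_1"
  assumes hom_0 [simp]: "h 0 = 0" and hom_1 [simp]: "h 1 = 1"
    and hom_add: "h (x + y) = h x + h y" and hom_mult: "h (x * y) = h x * h y"
begin

lemma hom_sum: "h (sum g A) = (\<Sum>x\<in>A. h (g x))"
  by (induction A rule: infinite_finite_induct) (auto simp: hom_add)

lemma hom_prod: "h (prod g A) = (\<Prod>x\<in>A. h (g x))"
  by (induction A rule: infinite_finite_induct) (auto simp: hom_mult)

lemma hom_power: "h (x ^ k) = h x ^ k"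
  by (induction k) (auto simp: hom_mult)

lemma map_poly_add: "map_poly h (p + q) = map_poly h p + map_poly h q"
  by (rule poly_eqI) (simp add: coeff_map_poly hom_add)

lemma map_poly_mult: "map_poly h (p * q) = map_poly h p * map_poly h q"
  by (rule poly_eqI) (simp add: coeff_map_poly coeff_mult hom_sum hom_mult)

lemma map_poly_hom: "ring_hom_0 (map_poly h)"
  by unfold_locales (auto simp: map_poly_add map_poly_mult)

lemma poly_map_poly: "poly (map_poly h p) (h x) = h (poly p x)"
proof (induction p)
  case (pCons a p)
  then show ?case by (cases "p = 0 \<and> a = 0") (auto simp: map_poly_pCons hom_add hom_mult)
qed simp

text \<open>The homomorphism given by the universal property of the polynomial ring:
  \<open>h\<close> on coefficients, \<open>s\<close> on variables.\<close>

definition aeval :: "('i \<Rightarrow> 'b) \<Rightarrow> ('i, 'a) mpoly \<Rightarrow> 'b" where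
  "aeval s f = (\<Sum>m\<in>Poly_Mapping.keys f. h (Poly_Mapping.lookup f m) * mono_eval s m)"

lemma aeval_superset:
  assumes "finite S" "Poly_Mapping.keys f \<subseteq> S"
  shows "aeval s f = (\<Sum>m\<in>S. h (Poly_Mapping.lookup f m) * mono_eval s m)"
  unfolding aeval_def
  by (rule sum.mono_neutral_left) (use assms in \<open>auto simp: in_keys_iff\<close>)

lemma aeval_single [simp]: "aeval s (Poly_Mapping.single m c) = h c * mono_eval s m"
  by (simp add: aeval_def)

lemma aeval_Var [simp]: "aeval s (Var i) = s i"
  by (simp add: Var_def)

lemma aeval_Const [simp]: "aeval s (Const c) = h c"
  by (simp add: Const_def)

lemma aeval_add: "aeval s (f + g) = aeval s f + aeval s g"
proof -
  let ?S = "Poly_Mapping.keys f \<union> Poly_Mapping.keys g"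
  have "aeval s (f + g) = (\<Sum>m\<in>?S. h (Poly_Mapping.lookup (f + g) m) * mono_eval s m)"
    by (rule aeval_superset) (auto dest: subsetD[OF keys_add])
  also have "\<dots> = aeval s f + aeval s g"
    by (simp add: aeval_superset[of ?S] lookup_add hom_add distrib_right sum.distrib)
  finally show ?thesis .
qed

lemma aeval_mult: "aeval s (f * g) = aeval s f * aeval s g"
proof (induction f rule: mpoly_induct)
  case (single m c)
  show ?case
  proof (induction g rule: mpoly_induct)
    case (single m' c')
    show ?case by (simp add: mult_single hom_mult mono_eval_add ac_simps)
  qed (simp add: aeval_add distrib_left)
qed (simp add: aeval_add distrib_right)

lemma aeval_hom: "ring_hom_0 (aeval s)"
  by unfold_locales (auto simp: aeval_add aeval_mult, auto simp: aeval_def)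

end

lemma Var_power: "Var i ^ k = Poly_Mapping.single (Poly_Mapping.single i k) 1"
  by (induction k) (simp_all add: Var_def mult_single flip: single_add)

lemma single_conv_Var:
  fixes c :: "'a::comm_semiring_1" and m :: "'b \<Rightarrow>\<^sub>0 nat"
  shows "Poly_Mapping.single m c = Const c * mono_eval Var m"
proof -
  have "(\<Prod>i\<in>A. Poly_Mapping.single (g i) 1) = Poly_Mapping.single (sum g A) (1::'a)"
    if "finite A" for A and g :: "'b \<Rightarrow> 'b \<Rightarrow>\<^sub>0 nat"
    using that by (induction A rule: finite_induct) (auto simp: mult_single)
  then have "mono_eval Var m = (Poly_Mapping.single m 1 :: ('b, 'a) mpoly)"
    unfolding mono_eval_def Var_power using mpoly_eq_sum_single[of m] by simp
  then show ?thesis by (simp add: Const_def mult_single)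
qed

text \<open>Constants and variables generate the polynomial ring. Identities between evaluation maps
  thus reduce to a check on generators.\<close>

lemma mpoly_hom_eqI:
  fixes h h' :: "('i, 'a::comm_semiring_1) mpoly \<Rightarrow> 'b::comm_semiring_1"
  assumes "ring_hom_0 h" "ring_hom_0 h'"
    and C: "\<And>c. h (Const c) = h' (Const c)" and V: "\<And>i. h (Var i) = h' (Var i)"
  shows "h f = h' f"
proof -
  interpret h: ring_hom_0 h by fact
  interpret h': ring_hom_0 h' by fact
  show ?thesis
    by (induction f rule: mpoly_induct) (auto simp: single_conv_Var mono_eval_def C V h.hom_add h'.hom_add h.hom_mult h'.hom_mult
        h.hom_prod h'.hom_prod h.hom_power h'.hom_power)
qed

lemma id_hom: "ring_hom_0 (\<lambda>x::'a::comm_semiring_1. x)"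
  by (rule ring_hom_0.intro) auto

interpretation Const_hom: ring_hom_0 "Const :: 'a::comm_semiring_1 \<Rightarrow> ('i, 'a) mpoly"
  by unfold_locales (auto simp: Const_def single_add mult_single)

interpretation Const_poly_hom: ring_hom_0 "\<lambda>c::'a::comm_semiring_1. [:Const c :: ('i, 'a) mpoly:]"
  by unfold_locales (auto simp: Const_hom.hom_add Const_hom.hom_mult one_pCons mult.commute)

lemma ring_hom_0_comp: "ring_hom_0 g \<Longrightarrow> ring_hom_0 h \<Longrightarrow> ring_hom_0 (\<lambda>x. g (h x))"
  by (simp add: ring_hom_0_def)

lemma ring_hom_0_poly: "ring_hom_0 (\<lambda>p. poly p z)"
  by unfold_locales auto

lemma poly_eval_conv_aeval: "poly_eval f v = ring_hom_0.aeval (\<lambda>x. x) v f"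
  by (simp add: poly_eval_def ring_hom_0.aeval_def[OF id_hom] mono_eval_def)

lemma poly_eval_hom: "ring_hom_0 (\<lambda>f. poly_eval f v)"
  unfolding poly_eval_conv_aeval by (rule ring_hom_0.aeval_hom[OF id_hom])

interpretation poly_eval: ring_hom_0 "\<lambda>f. poly_eval f v"
  by (rule poly_eval_hom)

lemma poly_eval_Var [simp]: "poly_eval (Var i) v = v i"
  by (simp add: poly_eval_conv_aeval ring_hom_0.aeval_Var[OF id_hom])

lemma poly_eval_Const [simp]: "poly_eval (Const c) v = c"
  by (simp add: poly_eval_conv_aeval ring_hom_0.aeval_Const[OF id_hom])

lemma poly_eval_single [simp]: "poly_eval (Poly_Mapping.single m c) v = c * mono_eval v m"
  by (simp add: poly_eval_conv_aeval ring_hom_0.aeval_single[OF id_hom])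

lemma vars_0 [simp]: "vars 0 = {}" and vars_1 [simp]: "vars 1 = {}"
  and vars_Const [simp]: "vars (Const c) = {}"
  by (auto simp: vars_def Const_def)

lemma vars_Var [simp]: "vars (Var i :: ('i, 'a::comm_semiring_1) mpoly) = {i}"
  by (auto simp: vars_def Var_def)

lemma finite_vars: "finite (vars f)"
  by (simp add: vars_def)

lemma vars_add: "vars (f + g) \<subseteq> vars f \<union> vars g"
  using keys_add[of f g] by (fastforce simp: vars_def)

lemma vars_mult: "vars (f * g) \<subseteq> vars f \<union> vars g"
proof
  fix i assume "i \<in> vars (f * g)"
  then obtain m where m: "m \<in> Poly_Mapping.keys (f * g)" "i \<in> Poly_Mapping.keys m"
    by (auto simp: vars_def)
  then obtain a b where "m = a + b" "a \<in> Poly_Mapping.keys f" "b \<in> Poly_Mapping.keys g"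
    using keys_mult[of f g] by auto
  with m keys_add[of a b] show "i \<in> vars f \<union> vars g"
    by (auto simp: vars_def)
qed

lemma vars_sum: "(\<And>x. x \<in> A \<Longrightarrow> vars (g x) \<subseteq> I) \<Longrightarrow> vars (sum g A) \<subseteq> I"
  by (induction A rule: infinite_finite_induct) (use vars_add in fastforce)+

lemma vars_prod: "(\<And>x. x \<in> A \<Longrightarrow> vars (g x) \<subseteq> I) \<Longrightarrow> vars (prod g A) \<subseteq> I"
  by (induction A rule: infinite_finite_induct) (use vars_mult in fastforce)+

lemma poly_eval_cong:
  assumes "\<And>i. i \<in> vars f \<Longrightarrow> v i = w i"
  shows "poly_eval f v = poly_eval f w"
  unfolding poly_eval_def
  by (intro sum.cong prod.cong refl arg_cong2[of _ _ _ _ "(*)"] arg_cong2[of _ _ _ _ "(^)"] assms)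
    (auto simp: vars_def)

section \<open>Polynomials as functions on an infinite field\<close>

text \<open>Regards \<open>f\<close> as univariate in \<open>Var i\<close> over the ring in the
  other variables, the form suited to induction on the set of variables.\<close>

definition separate_var :: "'i \<Rightarrow> ('i, 'a::comm_semiring_1) mpoly \<Rightarrow> ('i, 'a) mpoly poly" where
  "separate_var i = Const_poly_hom.aeval (\<lambda>j. if j = i then [:0, 1:] else [:Var j:])"

lemma poly_separate_var:
  fixes f :: "('i, 'a::comm_semiring_1) mpoly"
  shows "poly (separate_var i f) (Var i) = f"
proof (rule mpoly_hom_eqI)
  show "ring_hom_0 (\<lambda>f :: ('i, 'a) mpoly. poly (separate_var i f) (Var i))"
    unfolding separate_var_def
    by (intro ring_hom_0_comp[OF ring_hom_0_poly] Const_poly_hom.aeval_hom)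
qed (auto simp: separate_var_def intro: id_hom)

text \<open>Univariate polynomials with coefficients in the variables \<open>J\<close> are closed
  under products and contain the images of the constants and of the variables of
  \<open>f\<close>.\<close>

lemma vars_coeff_separate_var: "vars (coeff (separate_var i f) n) \<subseteq> vars f - {i}"
proof -
  define J where "J = vars f - {i}"
  define Q :: "('a, 'b) mpoly poly \<Rightarrow> bool" where "Q = (\<lambda>p. \<forall>n. vars (coeff p n) \<subseteq> J)"
  have mult: "Q (p * q)" if "Q p" "Q q" for p q
    using that unfolding Q_def coeff_mult
    by (intro allI vars_sum order.trans[OF vars_mult]) (auto simp: Q_def)
  have one: "Q 1" by (auto simp: Q_def one_pCons coeff_pCons split: nat.splits)
  have pow: "Q (p ^ k)" if "Q p" for p k
    by (induction k) (use that one mult in auto)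
  have prod: "Q (prod g A)" if "\<And>x. x \<in> A \<Longrightarrow> Q (g x)" for A and g :: "'a \<Rightarrow> _"
    using that by (induction A rule: infinite_finite_induct) (auto intro: one mult)
  have "Q (separate_var i f)"
    unfolding Q_def separate_var_def Const_poly_hom.aeval_def coeff_sum
  proof (intro allI vars_sum)
    fix n m assume m: "m \<in> Poly_Mapping.keys f"
    have "Q (mono_eval (\<lambda>j. if j = i then [:0, 1:] else [:Var j:]) m)"
      unfolding mono_eval_def
    proof (intro prod pow)
      fix j assume "j \<in> Poly_Mapping.keys m"
      with m show "Q (if j = i then [:0, 1:] else [:Var j:])"
        by (auto simp: Q_def J_def coeff_pCons vars_def split: nat.splits)
          (auto simp: Var_def)
    qed
    moreover have "Q [:Const (poly_mapping.lookup f m):]"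
      by (auto simp: Q_def coeff_pCons split: nat.splits)
    ultimately show "vars (coeff ([:Const (poly_mapping.lookup f m):] *
        mono_eval (\<lambda>j. if j = i then [:0, 1:] else [:Var j:]) m) n) \<subseteq> J"
      using mult unfolding Q_def by blast
  qed
  then show ?thesis by (simp add: Q_def J_def)
qed

text \<open>Induction on the set of variables: some coefficient in the split-off variable survives
  at a point, and the resulting nonzero univariate polynomial has only finitely many roots.\<close>

lemma poly_eval_nonzero:
  fixes f :: "('i, 'a::field) mpoly"
  assumes "infinite (UNIV :: 'a set)" "f \<noteq> 0"
  shows "\<exists>v. poly_eval f v \<noteq> 0"
proof -
  have "\<exists>v. poly_eval f v \<noteq> 0" if "finite I" "vars f \<subseteq> I" "f \<noteq> 0" for I and f :: "('i, 'a) mpoly"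
    using that
  proof (induction I arbitrary: f rule: finite_induct)
    case empty
    then have "Poly_Mapping.keys f \<subseteq> {0}" by (auto simp: vars_def)
    with empty have "f = Poly_Mapping.single 0 (Poly_Mapping.lookup f 0)" "Poly_Mapping.lookup f 0 \<noteq> 0"
      by (subst mpoly_eq_sum_single, auto simp: subset_singleton_iff)+
    then show ?case by (metis poly_eval_single mono_eval_0 mult.right_neutral)
  next
    case (insert i I)
    have "separate_var i f \<noteq> 0"
      using poly_separate_var[of i f] insert.prems by auto
    then obtain n where n: "coeff (separate_var i f) n \<noteq> 0"
      by (auto simp: poly_eq_iff)
    have "vars (coeff (separate_var i f) n) \<subseteq> I"
      using vars_coeff_separate_var[of i f n] insert.prems by auto
    then obtain v where v: "poly_eval (coeff (separate_var i f) n) v \<noteq> 0"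
      using insert.IH n by blast
    define q where "q = map_poly (\<lambda>a. poly_eval a v) (separate_var i f)"
    have "q \<noteq> 0" using v by (auto simp: q_def poly_eq_iff coeff_map_poly)
    then obtain z where z: "poly q z \<noteq> 0"
      using poly_roots_finite[of q] assms(1) by (metis (mono_tags) UNIV_eq_I mem_Collect_eq)
    have eq: "poly (map_poly (\<lambda>a. poly_eval a v) (separate_var i f)) z = poly_eval f (v(i := z))"
    proof (rule mpoly_hom_eqI)
      show "ring_hom_0 (\<lambda>f. poly (map_poly (\<lambda>a. poly_eval a v) (separate_var i f)) z)"
        unfolding separate_var_def
        by (intro ring_hom_0_comp[OF ring_hom_0_poly] ring_hom_0_comp[OF poly_eval.map_poly_hom]
            Const_poly_hom.aeval_hom)
    qed (auto simp: separate_var_def map_poly_pCons intro: poly_eval_hom)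
    then show ?case using z unfolding q_def by metis
  qed
  then show ?thesis using finite_vars assms by blast
qed

text \<open>Over a finite field, one plus the product of all x - a is nonconstant without a
  root.\<close>

lemma infinite_UNIV_alg_closed: "infinite (UNIV :: 'a::alg_closed_field set)"
proof
  assume fin: "finite (UNIV :: 'a set)"
  define p :: "'a poly" where "p = (\<Prod>a\<in>UNIV. [:-a, 1:])"
  have deg: "degree p = card (UNIV :: 'a set)"
    unfolding p_def by (subst degree_prod_eq_sum_degree) auto
  moreover have "card (UNIV :: 'a set) > 0" using fin by (simp add: card_gt_0_iff)
  ultimately have "degree (p + 1) > 0" by (simp add: degree_add_eq_left)
  then obtain x where "poly (p + 1) x = 0" using alg_closed_imp_poly_has_root by blast
  moreover have "poly p x = 0" unfolding p_def poly_prod using fin by (simp add: prod_zero_iff)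
  ultimately show False by simp
qed

section \<open>Restriction to parallel lines\<close>

text \<open>This is f(x + T p) as a polynomial in T. The base point x stays generic, so all lines of
  direction \<open>p\<close> are treated at once.\<close>

definition line_poly :: "('i \<Rightarrow> 'a) \<Rightarrow> ('i, 'a::comm_semiring_1) mpoly \<Rightarrow> ('i, 'a) mpoly poly" where
  "line_poly p = Const_poly_hom.aeval (\<lambda>i. [:Var i, Const (p i):])"

lemma line_poly_hom: "ring_hom_0 (line_poly p)"
  unfolding line_poly_def by (rule Const_poly_hom.aeval_hom)

interpretation line_poly: ring_hom_0 "line_poly p"
  by (rule line_poly_hom)

lemma line_poly_Var [simp]: "line_poly p (Var i) = [:Var i, Const (p i):]"
  by (simp add: line_poly_def)

lemma line_poly_Const [simp]: "line_poly p (Const c) = [:Const c:]"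
  by (simp add: line_poly_def)

lemma poly_line_poly_0 [simp]: "poly (line_poly p f) 0 = f"
proof (rule mpoly_hom_eqI)
  show "ring_hom_0 (\<lambda>f. poly (line_poly p f) 0)"
    by (intro ring_hom_0_comp[OF ring_hom_0_poly] line_poly_hom)
qed (auto intro: id_hom)

lemma map_line_poly_hom: "ring_hom_0 (\<lambda>f. map_poly (\<lambda>a. poly_eval a w) (line_poly p f))"
  by (intro ring_hom_0_comp[OF poly_eval.map_poly_hom] line_poly_hom)

lemma poly_map_line_poly:
  "poly (map_poly (\<lambda>a. poly_eval a w) (line_poly p f)) z = poly_eval f (\<lambda>i. w i + z * p i)"
proof (rule mpoly_hom_eqI)
  show "ring_hom_0 (\<lambda>f. poly (map_poly (\<lambda>a. poly_eval a w) (line_poly p f)) z)"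
    by (intro ring_hom_0_comp[OF ring_hom_0_poly] map_line_poly_hom)
qed (auto simp: map_poly_pCons intro: poly_eval_hom)

lemma poly_eval_line_poly:
  "poly_eval (poly (line_poly p f) s) w = poly_eval f (\<lambda>i. w i + poly_eval s w * p i)"
  by (simp add: poly_map_line_poly flip: poly_eval.poly_map_poly)

text \<open>Bounds replace exact degrees because a factor x_i + T p_i drops to degree 0 when p_i =
  0.\<close>

lemma coeff_mult_bound:
  fixes P Q :: "'a::comm_semiring_0 poly"
  assumes "degree P \<le> m" "degree Q \<le> n"
  shows "coeff (P * Q) (m + n) = coeff P m * coeff Q n"
proof (cases "degree P = m \<and> degree Q = n")
  case True
  then show ?thesis using coeff_mult_degree_sum[of P Q] by simp
next
  case False
  then have "degree (P * Q) < m + n" "coeff P m = 0 \<or> coeff Q n = 0"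
    using assms degree_mult_le[of P Q] by (auto intro: coeff_eq_0)
  then show ?thesis by (auto simp: coeff_eq_0)
qed

lemma line_poly_mono:
  fixes p :: "'i \<Rightarrow> 'a::comm_semiring_1"
  defines "M \<equiv> mono_eval (\<lambda>i. [:Var i, Const (p i):])"
  shows "degree (M m) \<le> mdeg m \<and> coeff (M m) (mdeg m) = Const (mono_eval p m)"
proof -
  define g :: "'i \<Rightarrow> ('i, 'a) mpoly poly" where "g = (\<lambda>i. [:Var i, Const (p i):])"
  have g: "degree (g i) \<le> 1" "coeff (g i) 1 = Const (p i)" for i
    by (simp_all add: g_def)
  have pow: "degree (g i ^ k) \<le> k \<and> coeff (g i ^ k) k = Const (p i) ^ k" for i k
  proof (induction k)
    case (Suc k)
    then show ?case
      using coeff_mult_bound[OF g(1), of "g i ^ k" k] degree_mult_le[of "g i" "g i ^ k"] g[of i]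
      by simp
  qed simp
  have "degree (\<Prod>i\<in>A. g i ^ e i) \<le> sum e A \<and>
     coeff (\<Prod>i\<in>A. g i ^ e i) (sum e A) = (\<Prod>i\<in>A. Const (p i) ^ e i)" if "finite A" for A e
    using that
  proof (induction A rule: finite_induct)
    case (insert x A)
    then show ?case
      using coeff_mult_bound[of "g x ^ e x" "e x" "\<Prod>i\<in>A. g i ^ e i" "sum e A"] pow[of x "e x"]
       degree_mult_le[of "g x ^ e x" "\<Prod>i\<in>A. g i ^ e i"]
      by simp
  qed simp
  from this[of "Poly_Mapping.keys m" "Poly_Mapping.lookup m"] show ?thesis
    by (simp add: M_def g_def mono_eval_def mdeg_def Const_hom.hom_prod Const_hom.hom_power)
qed

text \<open>Only monomials of degree \<open>D\<close> can reach T^D, so the coefficient there is the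
  value at \<open>p\<close> of the part of degree \<open>D\<close> and does not involve x.\<close>

lemma line_poly_degree:
  assumes "\<And>m. m \<in> Poly_Mapping.keys f \<Longrightarrow> mdeg m \<le> D"
  shows "degree (line_poly p f) \<le> D"
    and "coeff (line_poly p f) D =
      Const (\<Sum>m\<in>{m\<in>Poly_Mapping.keys f. mdeg m = D}. Poly_Mapping.lookup f m * mono_eval p m)"
proof -
  define M where "M = mono_eval (\<lambda>i. [:Var i, Const (p i):])"
  have eq: "line_poly p f = (\<Sum>m\<in>Poly_Mapping.keys f. smult (Const (Poly_Mapping.lookup f m)) (M m))"
    by (simp add: line_poly_def Const_poly_hom.aeval_def M_def)
  note M = line_poly_mono[of p, folded M_def]
  show "degree (line_poly p f) \<le> D"
    unfolding eq
    by (intro degree_sum_le order.trans[OF degree_smult_le]) (use M assms in \<open>auto intro: order.trans\<close>)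
  have "coeff (line_poly p f) D = (\<Sum>m\<in>Poly_Mapping.keys f.
     if mdeg m = D then Const (Poly_Mapping.lookup f m * mono_eval p m) else 0)"
    unfolding eq coeff_sum
  proof (intro sum.cong refl)
    fix m assume m: "m \<in> Poly_Mapping.keys f"
    have "coeff (M m) D = 0" if "mdeg m \<noteq> D"
      using that assms[OF m] M[of m] by (intro coeff_eq_0) auto
    then show "coeff (smult (Const (Poly_Mapping.lookup f m)) (M m)) D =
      (if mdeg m = D then Const (Poly_Mapping.lookup f m * mono_eval p m) else 0)"
      using M[of m] by (auto simp: Const_hom.hom_mult)
  qed
  also have "\<dots> = (\<Sum>m\<in>{m\<in>Poly_Mapping.keys f. mdeg m = D}.
     Const (Poly_Mapping.lookup f m * mono_eval p m))"
    by (simp add: sum.If_cases Int_def)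
  finally show "coeff (line_poly p f) D =
      Const (\<Sum>m\<in>{m\<in>Poly_Mapping.keys f. mdeg m = D}. Poly_Mapping.lookup f m * mono_eval p m)"
    by (simp add: Const_hom.hom_sum)
qed

lemma line_poly_form:
  assumes "is_form I d f"
  shows "degree (line_poly p f) \<le> d" "coeff (line_poly p f) d = Const (poly_eval f p)"
proof -
  have *: "mdeg m = d" if "m \<in> Poly_Mapping.keys f" for m
    using assms that by (auto simp: is_form_def)
  show "degree (line_poly p f) \<le> d" using line_poly_degree(1)[of f d p] * by simp
  have "{m\<in>Poly_Mapping.keys f. mdeg m = d} = Poly_Mapping.keys f" using * by auto
  then show "coeff (line_poly p f) d = Const (poly_eval f p)"
    using line_poly_degree(2)[of f d p] * by (simp add: poly_eval_def mono_eval_def)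
qed

lemma Const_eq_0_iff [simp]: "Const c = 0 \<longleftrightarrow> c = 0"
  by (metis Const_hom.hom_0 poly_eval_Const)

text \<open>The top homogeneous part \<open>T\<close> is a nonzero polynomial; any direction
  \<open>p\<close> where it does not vanish is general enough.\<close>

lemma ex_line_poly_lead_coeff_Const:
  fixes f :: "('i, 'a::field) mpoly"
  assumes "infinite (UNIV :: 'a set)" "f \<noteq> 0"
  obtains p c where "lead_coeff (line_poly p f) = Const c" "c \<noteq> 0"
proof -
  define D where "D = Max (mdeg ` Poly_Mapping.keys f)"
  have ne: "Poly_Mapping.keys f \<noteq> {}" using assms by simp
  have le: "mdeg m \<le> D" if "m \<in> Poly_Mapping.keys f" for m using that by (simp add: D_def)
  have "D \<in> mdeg ` Poly_Mapping.keys f" unfolding D_def using ne by (intro Max_in) auto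
  then obtain m0 where m0: "m0 \<in> Poly_Mapping.keys f" "mdeg m0 = D" by auto
  let ?K = "{m\<in>Poly_Mapping.keys f. mdeg m = D}"
  define T where "T = (\<Sum>m\<in>?K. Poly_Mapping.single m (Poly_Mapping.lookup f m))"
  have "Poly_Mapping.lookup T m0 = Poly_Mapping.lookup f m0"
    using m0 by (auto simp: T_def lookup_sum lookup_single when_def sum.delta)
  then have "T \<noteq> 0" using m0 by (auto simp: in_keys_iff)
  then obtain p where p: "poly_eval T p \<noteq> 0" using poly_eval_nonzero assms by blast
  have "poly_eval T p = (\<Sum>m\<in>?K. Poly_Mapping.lookup f m * mono_eval p m)"
    by (simp add: T_def poly_eval.hom_sum)
  then have "coeff (line_poly p f) D = Const (poly_eval T p)"
    using line_poly_degree(2)[OF le] by simp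
  moreover from this p have "degree (line_poly p f) = D"
    using line_poly_degree(1)[OF le] by (intro antisym le_degree) auto
  ultimately show thesis using p that by metis
qed

section \<open>Irreducible forms and their zeros\<close>

text \<open>
  The content argument behind Gauss's lemma, with the roots of \<open>b\<close> in place of its prime factors.
\<close>

lemma const_factor_dvd_of_mult:
  fixes P Q h :: "'a::alg_closed_field poly poly"
  assumes "P * Q = smult (b * c) h" "lead_coeff P = b" "lead_coeff Q = c" "b \<noteq> 0" "c \<noteq> 0"
  shows "[:b:] dvd P"
  using assms
proof (induction "degree b + degree c" arbitrary: P Q b c rule: less_induct)
  case less
  show ?case
  proof (cases "degree b = 0")
    case True
    then have "b dvd 1" using less.prems is_unit_iff_degree by blast
    then have "b dvd coeff P n" for n by (rule dvd_trans) simp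
    then show ?thesis by (simp add: const_poly_dvd_iff)
  next
    case False
    then obtain z where z: "poly b z = 0" using alg_closed_imp_poly_has_root by blast
    define e :: "'a poly \<Rightarrow> 'a" where "e = (\<lambda>a. poly a z)"
    interpret e: ring_hom_0 e unfolding e_def by (rule ring_hom_0_poly)
    define l where "l = [:-z, 1:]"
    have l: "l \<noteq> 0" "degree l = 1" by (auto simp: l_def)
    \<comment> \<open>If all coefficients vanish at \<open>z\<close>, then \<open>l\<close>, that is
      x - z, can be pulled out of all of them, the leading one included.\<close>
    have quot: "\<exists>R'. R = smult l R' \<and> lead_coeff R = l * lead_coeff R'"
      if "map_poly e R = 0" for R
    proof -
      have "l dvd coeff R n" for n
        using arg_cong[OF that, of "\<lambda>p. coeff p n"]
        by (simp add: coeff_map_poly e_def l_def poly_eq_0_iff_dvd)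
      then have "[:l:] dvd R" by (simp add: const_poly_dvd_iff)
      then obtain R' where "R = smult l R'" by (auto elim!: dvdE)
      then show ?thesis by (metis lead_coeff_smult)
    qed
    \<comment> \<open>Modulo x - z the product vanishes because \<open>b\<close> does; in a domain
      one of the two factors vanishes.\<close>
    have "map_poly e P * map_poly e Q = map_poly e (smult (b * c) h)"
      using less.prems by (simp flip: e.map_poly_mult)
    also have "\<dots> = 0"
      using z by (intro poly_eqI) (simp add: coeff_map_poly e.hom_mult, simp add: e_def)
    finally consider "map_poly e P = 0" | "map_poly e Q = 0" by auto
    then show ?thesis
    proof cases
      \<comment> \<open>Removing \<open>l\<close> from \<open>P\<close> lowers the degree of
        \<open>b\<close>; multiplying back recovers the divisor \<open>b\<close>.\<close>
      case 1
      then obtain P' where P': "P = smult l P'" "b = l * lead_coeff P'"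
        using quot less.prems by blast
      then have "smult l (P' * Q) = smult l (smult (lead_coeff P' * c) h)"
        using less.prems by (simp add: ac_simps)
      then have eq: "P' * Q = smult (lead_coeff P' * c) h" using l by (simp add: smult_cancel)
      have nz: "lead_coeff P' \<noteq> 0" using less.prems P' by auto
      have "[:lead_coeff P':] dvd P'"
        by (rule less.hyps[OF _ eq]) (use less.prems P' nz l in \<open>auto simp: degree_mult_eq\<close>)
      then show ?thesis using P'
        by (metis const_poly_dvd_iff coeff_smult mult_dvd_mono dvd_refl)
    next
      \<comment> \<open>Here \<open>c\<close> loses the factor while \<open>P\<close> and
        \<open>b\<close> stay the same, so the induction hypothesis is already the claim.\<close>
      case 2
      then obtain Q' where Q': "Q = smult l Q'" "c = l * lead_coeff Q'"
        using quot less.prems by blast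
      then have "smult l (P * Q') = smult l (smult (b * lead_coeff Q') h)"
        using less.prems by (simp add: ac_simps)
      then have eq: "P * Q' = smult (b * lead_coeff Q') h" using l by (simp add: smult_cancel)
      have nz: "lead_coeff Q' \<noteq> 0" using less.prems Q' by auto
      show ?thesis
        by (rule less.hyps[OF _ eq]) (use less.prems Q' nz l in \<open>auto simp: degree_mult_eq\<close>)
    qed
  qed
qed

section \<open>Division with remainder, fraction fields and Bezout identities\<close>

lemma poly_division_unit_lead_coeff:
  fixes P Q :: "'a::idom poly"
  assumes "lead_coeff P dvd 1"
  obtains q r where "Q = P * q + r" "r = 0 \<or> degree r < degree P"
proof -
  \<comment> \<open>Pseudo-division multiplies \<open>Q\<close> by a power of the leading
    coefficient of \<open>P\<close>, which is a unit and can be divided out again.\<close>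
  obtain q r where qr: "pseudo_divmod Q P = (q, r)" by force
  have "P \<noteq> 0" using assms by auto
  note pd = pseudo_divmod[OF this qr]
  define k where "k = Suc (degree Q) - degree P"
  obtain u0 where "lead_coeff P * u0 = 1" using assms by (metis dvdE)
  then have "lead_coeff P ^ k * u0 ^ k = 1" by (metis power_mult_distrib power_one)
  then obtain u where u: "lead_coeff P ^ k * u = 1" by blast
  have "smult u (smult (lead_coeff P ^ k) Q) = smult u (P * q + r)"
    using pd(1) by (simp add: k_def)
  then have "Q = P * smult u q + smult u r"
    using u by (simp add: smult_add_right ac_simps)
  moreover have "smult u r = 0 \<or> degree (smult u r) < degree P"
    using pd(2) degree_smult_le[of u r] by auto
  ultimately show thesis using that by blast
qed

interpretation to_fract: ring_hom_0 "to_fract :: 'a::idom \<Rightarrow> 'a fract"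
  by (rule ring_hom_0.intro) auto

text \<open>Division with remainder takes place over the base ring; over the fraction field the
  remainder is still a multiple of \<open>P\<close> but of smaller degree, hence zero.\<close>

lemma dvd_of_fract_poly_dvd:
  fixes P Q :: "'a::idom poly"
  assumes "fract_poly P dvd fract_poly Q" "lead_coeff P dvd 1"
  shows "P dvd Q"
proof -
  obtain q r where qr: "Q = P * q + r" "r = 0 \<or> degree r < degree P"
    using poly_division_unit_lead_coeff[OF assms(2)] by blast
  have "fract_poly r = fract_poly Q - fract_poly P * fract_poly q" by (simp add: qr)
  then have "fract_poly P dvd fract_poly r" using assms(1) by simp
  then have "r = 0"
    using qr(2) dvd_imp_degree_le[of "fract_poly P" "fract_poly r"]
    by (cases "r = 0") (simp_all add: degree_map_poly)
  then show ?thesis using qr by simp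
qed

lemma clear_denominators:
  fixes A :: "'a::idom fract poly"
  obtains c A' where "c \<noteq> 0" "smult (to_fract c) A = fract_poly A'"
proof -
  have "\<exists>c A'. c \<noteq> 0 \<and> smult (to_fract c) A = fract_poly A'"
  proof (induction A)
    case 0
    show ?case by (intro exI[of _ 1] exI[of _ 0]) simp
  next
    case (pCons a A)
    then obtain c A' where A': "c \<noteq> 0" "smult (to_fract c) A = fract_poly A'" by blast
    obtain x y where xy: "a = to_fract x / to_fract y" "y \<noteq> 0"
      by (cases a) (auto simp: Fract_conv_to_fract)
    have "smult (to_fract (y * c)) (pCons a A) = fract_poly (pCons (x * c) (smult y A'))"
      using A' xy by (simp add: map_poly_pCons flip: smult_smult)
    then show ?case using A' xy by (metis mult_eq_0_iff)
  qed
  then show thesis using that by blast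
qed

lemma prime_elem_dvd_prod:
  assumes "prime_elem p" "p dvd prod g A"
  shows "\<exists>x\<in>A. p dvd g x"
  using assms(2)
proof (induction A rule: infinite_finite_induct)
  case (insert x A)
  then show ?case using prime_elem_dvd_multD[OF assms(1), of "g x" "prod g A"] by auto
qed (use assms(1) in \<open>auto simp: prime_elem_def\<close>)

text \<open>A nonzero combination of \<open>p\<close> and \<open>q\<close> of least degree divides
  every combination, hence both; as \<open>p\<close> is prime and does not divide \<open>q\<close>,
  it is a unit.\<close>

lemma prime_elem_bezout:
  fixes p q :: "'a::field poly"
  assumes "prime_elem p" "\<not> p dvd q"
  obtains u v where "u * p + v * q = 1"
proof -
  define S where "S = {g. g \<noteq> 0 \<and> (\<exists>u v. g = u * p + v * q)}"
  have "p \<noteq> 0" using assms by auto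
  then have "p \<in> S" unfolding S_def by (auto intro: exI[of _ 1] exI[of _ 0])
  then obtain g where g: "g \<in> S" and min: "\<And>g'. g' \<in> S \<Longrightarrow> degree g \<le> degree g'"
    using exists_least_iff[of "\<lambda>n. \<exists>g\<in>S. degree g = n"] by (metis not_less)
  obtain u v where uv: "g = u * p + v * q" "g \<noteq> 0" using g by (auto simp: S_def)
  have dvd: "g dvd s * p + t * q" for s t
  proof (rule ccontr)
    assume *: "\<not> g dvd s * p + t * q"
    define r where "r = (s * p + t * q) mod g"
    have "r = s * p + t * q - (s * p + t * q) div g * g"
      by (simp add: r_def minus_div_mult_eq_mod)
    moreover define x where "x = (s * p + t * q) div g"
    ultimately have "r = s * p + t * q - x * (u * p + v * q)" using uv(1) by simp
    then have "r = (s - x * u) * p + (t - x * v) * q" by (simp add: algebra_simps)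
    moreover have "r \<noteq> 0" using * by (auto simp: r_def dvd_eq_mod_eq_0)
    ultimately have "degree g \<le> degree r" by (intro min) (auto simp: S_def)
    moreover have "degree r < degree g"
      using \<open>r \<noteq> 0\<close> degree_mod_less[of g "s * p + t * q"] uv by (auto simp: r_def)
    ultimately show False by simp
  qed
  have "g dvd p" "g dvd q" using dvd[of 1 0] dvd[of 0 1] by auto
  then obtain k where k: "p = g * k" by blast
  have "\<not> p dvd g" using \<open>g dvd q\<close> assms dvd_trans by blast
  moreover have "p dvd g * k" using k by simp
  ultimately have "p dvd k" using assms(1) prime_elem_dvd_multD by blast
  then have "g dvd 1" using k \<open>p \<noteq> 0\<close>
    by (metis dvd_mult_cancel_right mult_1 mult_dvd_mono dvd_refl mult_eq_0_iff)
  then obtain w where "1 = g * w" by blast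
  then have "(w * u) * p + (w * v) * q = 1" by (simp add: uv algebra_simps)
  then show thesis by (rule that)
qed

lemma poly_eval_unit:
  assumes "(f :: ('i, 'a::field) mpoly) dvd 1"
  shows "poly_eval f v \<noteq> 0"
proof -
  obtain g where "1 = f * g" using assms by blast
  then have "poly_eval f v * poly_eval g v = 1"
    by (metis poly_eval.hom_1 poly_eval.hom_mult)
  then show ?thesis by auto
qed

lemma is_unit_Const: "c \<noteq> 0 \<Longrightarrow> (Const c :: ('i, 'a::field) mpoly) dvd 1"
  by (rule dvdI[of _ _ "Const (1 / c)"]) (simp flip: Const_hom.hom_mult)

lemma mpoly_eqI:
  fixes f g :: "('i, 'a::alg_closed_field) mpoly"
  assumes "\<And>v. poly_eval f v = poly_eval g v"
  shows "f = g"
proof -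
  have "poly_eval (f - g) v = 0" for v
    using assms[of v] poly_eval.hom_add[of "f - g" g v] by simp
  then show ?thesis using poly_eval_nonzero[OF infinite_UNIV_alg_closed, of "f - g"] by auto
qed

text \<open>
  Along the lines in a suitable direction \<open>b\<close> has a constant leading coefficient, so one can divide by it
  with remainder; by \<open>const_factor_dvd_of_mult\<close> on each single line the remainder vanishes.
\<close>

lemma lead_coeff_dvd_of_mult:
  fixes P Q h :: "('i::linorder, 'a::alg_closed_field) mpoly poly"
  assumes "P * Q = smult (b * c) h" "lead_coeff P = b" "lead_coeff Q = c" "b \<noteq> 0" "c \<noteq> 0"
  shows "[:b:] dvd P"
  unfolding const_poly_dvd_iff
proof
  fix n
  define a where "a = coeff P n"
  \<comment> \<open>A direction for the product \<open>b * c\<close> serves both factors: their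
    leading coefficients in T divide a nonzero constant.\<close>
  obtain p \<epsilon> where p: "lead_coeff (line_poly p (b * c)) = Const \<epsilon>" "\<epsilon> \<noteq> 0"
    using ex_line_poly_lead_coeff_Const[OF infinite_UNIV_alg_closed, of "b * c"] assms by auto
  define \<rho> where "\<rho> = (\<lambda>w a. map_poly (\<lambda>a. poly_eval a w) (line_poly p a))"
  have \<rho>: "ring_hom_0 (\<rho> w)" for w unfolding \<rho>_def by (rule map_line_poly_hom)
  have unit: "lead_coeff (line_poly p b) dvd 1"
    using p is_unit_Const[of \<epsilon>]
    by (metis line_poly.hom_mult lead_coeff_mult dvd_mult_left)
  obtain q r where qr: "line_poly p a = line_poly p b * q + r"
      "r = 0 \<or> degree r < degree (line_poly p b)"
    using poly_division_unit_lead_coeff[OF unit] by blast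
  have "r = 0"
  proof (rule ccontr)
    assume "r \<noteq> 0"
    then obtain k where k: "coeff r k \<noteq> 0" by (auto simp: poly_eq_iff)
    then obtain w where w: "poly_eval (coeff r k) w \<noteq> 0"
      using poly_eval_nonzero[OF infinite_UNIV_alg_closed] by blast
    interpret \<rho>: ring_hom_0 "\<rho> w" by (rule \<rho>)
    \<comment> \<open>\<open>\<rho> w\<close> restricts to the line through \<open>w\<close>. The
      leading coefficient of \<open>b * c\<close> in T is \<epsilon> for every \<open>w\<close>, so
      \<open>b\<close> and \<open>c\<close> do not vanish identically on this line and remain the
      leading coefficients of \<open>P\<close> and \<open>Q\<close>.\<close>
    have "coeff (\<rho> w (b * c)) (degree (line_poly p (b * c))) = \<epsilon>"
      using p by (simp add: \<rho>_def coeff_map_poly)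
    then have bc: "\<rho> w (b * c) \<noteq> 0" using p by auto
    then have b: "\<rho> w b \<noteq> 0" and c: "\<rho> w c \<noteq> 0" by (auto simp: \<rho>.hom_mult)
    have lP: "lead_coeff (map_poly (\<rho> w) P) = \<rho> w b" and lQ: "lead_coeff (map_poly (\<rho> w) Q) = \<rho> w c"
      using b c assms by (simp_all add: lead_coeff_map_poly_nz)
    have "map_poly (\<rho> w) P * map_poly (\<rho> w) Q = smult (\<rho> w b * \<rho> w c) (map_poly (\<rho> w) h)"
      using assms(1) by (simp add: map_poly_smult \<rho>.hom_mult flip: \<rho>.map_poly_mult)
    then have "[:\<rho> w b:] dvd map_poly (\<rho> w) P"
      using lP lQ b c by (rule const_factor_dvd_of_mult)
    then have "\<rho> w b dvd \<rho> w a" by (auto simp: const_poly_dvd_iff coeff_map_poly a_def)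
    moreover define R where "R = map_poly (\<lambda>a. poly_eval a w) r"
    have "\<rho> w a = \<rho> w b * map_poly (\<lambda>a. poly_eval a w) q + R"
      by (simp add: \<rho>_def R_def qr poly_eval.map_poly_add poly_eval.map_poly_mult)
    ultimately have "\<rho> w b dvd R" by (simp add: dvd_add_right_iff)
    moreover have "R \<noteq> 0" using w by (auto simp: R_def poly_eq_iff coeff_map_poly)
    \<comment> \<open>The restriction of \<open>b\<close> keeps its full degree in T, so it cannot
      divide the nonzero \<open>R\<close>, whose degree is smaller.\<close>
    ultimately have "degree (\<rho> w b) \<le> degree R" by (simp add: dvd_imp_degree_le)
    moreover have "degree R \<le> degree r" unfolding R_def by (simp add: map_poly_degree_leq)
    moreover have "degree (line_poly p b) \<le> degree (\<rho> w b)"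
      using poly_eval_unit[OF unit] by (intro le_degree) (simp add: \<rho>_def coeff_map_poly)
    ultimately show False using qr \<open>r \<noteq> 0\<close> by auto
  qed
  then have "line_poly p a = line_poly p b * q" using qr by simp
  \<comment> \<open>At T = 0 the quotient along the lines becomes a quotient in the polynomial
    ring.\<close>
  then have "a = b * poly q 0" by (metis poly_line_poly_0 poly_mult)
  then show "b dvd coeff P n" by (simp add: a_def)
qed

section \<open>Irreducibility of f(x + T p) and the zeros of f\<close>

lemma poly_eval_form_scale:
  assumes "is_form I d f"
  shows "poly_eval f (\<lambda>i. z * v i) = z ^ d * poly_eval f v"
  unfolding poly_eval_def sum_distrib_left
proof (rule sum.cong)
  fix m assume "m \<in> Poly_Mapping.keys f"
  then have "mdeg m = d" using assms by (auto simp: is_form_def)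
  then have "(\<Prod>i\<in>Poly_Mapping.keys m. z ^ Poly_Mapping.lookup m i) = z ^ d"
    by (auto simp: mdeg_def power_sum)
  then show "poly_mapping.lookup f m * (\<Prod>i\<in>Poly_Mapping.keys m. (z * v i) ^ poly_mapping.lookup m i) =
         z ^ d * (poly_mapping.lookup f m * (\<Prod>i\<in>Poly_Mapping.keys m. v i ^ poly_mapping.lookup m i))"
    by (simp add: power_mult_distrib prod.distrib ac_simps)
qed simp

lemma degree_line_poly:
  assumes "is_form I d f" "poly_eval f p \<noteq> 0"
  shows "degree (line_poly p f) = d" "lead_coeff (line_poly p f) = Const (poly_eval f p)"
proof -
  show "degree (line_poly p f) = d"
    using line_poly_form[OF assms(1), of p] assms(2) by (intro antisym le_degree) auto
  then show "lead_coeff (line_poly p f) = Const (poly_eval f p)"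
    using line_poly_form[OF assms(1), of p] by simp
qed

text \<open>A factorization over the fraction field can be made monic over the polynomial ring, up
  to a constant. At T = 0 it factors \<open>f\<close> into polynomials that vanish at the origin and
  hence are not units.\<close>

lemma irreducible_fract_line_poly:
  fixes f :: "('i::linorder, 'a::alg_closed_field) mpoly"
  assumes form: "is_form I d f" and "d > 0" and irr: "irreducible f" and p: "poly_eval f p \<noteq> 0"
  shows "irreducible (fract_poly (line_poly p f))"
proof (rule irreducibleI)
  define L where "L = line_poly p f"
  define \<epsilon> where "\<epsilon> = poly_eval f p"
  have L: "degree L = d" "lead_coeff L = Const \<epsilon>" and \<epsilon>: "\<epsilon> \<noteq> 0"
    using degree_line_poly[OF form p] p by (auto simp: L_def \<epsilon>_def)
  then have "L \<noteq> 0" using \<open>d > 0\<close> by auto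
  then show "fract_poly (line_poly p f) \<noteq> 0" by (simp add: L_def)
  then show "\<not> is_unit (fract_poly (line_poly p f))"
    using L \<open>d > 0\<close> by (simp add: is_unit_iff_degree degree_map_poly L_def)
  fix A B assume AB: "fract_poly (line_poly p f) = A * B"
  show "is_unit A \<or> is_unit B"
  proof (rule ccontr)
    assume "\<not> (is_unit A \<or> is_unit B)"
    moreover have "A \<noteq> 0" "B \<noteq> 0" using AB \<open>L \<noteq> 0\<close> by (auto simp: L_def)
    ultimately have degAB: "degree A > 0" "degree B > 0" by (auto simp: is_unit_iff_degree)
    obtain \<alpha> A' where A': "\<alpha> \<noteq> 0" "smult (to_fract \<alpha>) A = fract_poly A'" by (rule clear_denominators)
    obtain \<beta> B' where B': "\<beta> \<noteq> 0" "smult (to_fract \<beta>) B = fract_poly B'" by (rule clear_denominators)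
    have "fract_poly (A' * B') = smult (to_fract (\<alpha> * \<beta>)) (A * B)"
      by (simp add: mult.commute flip: A'(2) B'(2))
    also have "\<dots> = fract_poly (smult (\<alpha> * \<beta>) L)" by (simp add: L_def flip: AB)
    finally have eq: "A' * B' = smult (\<alpha> * \<beta>) L" by (simp only: fract_poly_eq_iff)
    define b c where "b = lead_coeff A'" and "c = lead_coeff B'"
    have bc: "b * c = \<alpha> * \<beta> * Const \<epsilon>"
      using arg_cong[OF eq, of lead_coeff] L by (simp add: lead_coeff_mult b_def c_def)
    then have nz: "b \<noteq> 0" "c \<noteq> 0" using A' B' \<epsilon> by auto
    \<comment> \<open>\<open>h\<close> is the monic multiple of \<open>L\<close>; the cleared
      product is then exactly \<open>b * c\<close> times \<open>h\<close>.\<close>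
    define h where "h = smult (Const (1 / \<epsilon>)) L"
    have Lh: "L = smult (Const \<epsilon>) h" using \<epsilon> by (simp add: h_def flip: Const_hom.hom_mult)
    have eq': "A' * B' = smult (b * c) h" unfolding eq bc by (simp add: Lh)
    \<comment> \<open>Both leading coefficients can be divided out, which leaves monic factors of
      \<open>h\<close>.\<close>
    have "[:b:] dvd A'" using lead_coeff_dvd_of_mult[OF eq'] nz by (simp add: b_def c_def)
    then obtain P where P: "A' = smult b P" by (auto elim!: dvdE)
    have "B' * A' = smult (c * b) h" using eq' by (simp only: mult.commute)
    then have "[:c:] dvd B'" by (rule lead_coeff_dvd_of_mult) (use nz in \<open>simp_all add: b_def c_def\<close>)
    then obtain Q where Q: "B' = smult c Q" by (auto elim!: dvdE)
    have "smult (b * c) (P * Q) = smult (b * c) h" using eq' by (simp add: P Q mult.commute)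
    then have PQ: "P * Q = h" using nz by (metis mult_eq_0_iff smult_cancel)
    have "degree A' = degree A" "degree B' = degree B"
      using degree_map_poly[of to_fract A'] degree_map_poly[of to_fract B'] A'(1) B'(1)
      by (simp_all flip: A'(2) B'(2))
    then have degPQ: "degree P > 0" "degree Q > 0" using degAB nz by (auto simp: P Q)
    \<comment> \<open>Through the origin, f(z p) = z^d f(p) vanishes only for z = 0. The leading
      coefficient of \<open>P\<close> is a unit, so specializing x to 0 keeps the degree of
      \<open>P\<close> and leaves a root, which must be 0.\<close>
    have root: "poly_eval (poly P 0) (\<lambda>_. 0) = 0" if PQ: "P * Q = h" and degP: "degree P > 0" for P Q
    proof -
      define ev where "ev = (\<lambda>a :: ('i, 'a) mpoly. poly_eval a (\<lambda>_. 0))"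
      interpret ev: ring_hom_0 ev unfolding ev_def by (rule poly_eval_hom)
      have "lead_coeff P * lead_coeff Q = 1"
        using L \<epsilon> by (simp add: h_def PQ flip: lead_coeff_mult Const_hom.hom_mult)
      then have "ev (lead_coeff P) * ev (lead_coeff Q) = 1" by (simp flip: ev.hom_mult)
      then have "coeff (map_poly ev P) (degree P) \<noteq> 0" by (auto simp: coeff_map_poly)
      then have "degree (map_poly ev P) > 0" using degP le_degree by (metis order.strict_trans2)
      then obtain z where z: "poly (map_poly ev P) z = 0" using alg_closed_imp_poly_has_root by blast
      then have "poly (map_poly ev (smult (Const \<epsilon>) h)) z = 0"
        by (simp add: map_poly_smult ev.hom_mult ev.map_poly_mult flip: PQ)
      then have "poly_eval f (\<lambda>i. z * p i) = 0"
        using poly_map_line_poly[of "\<lambda>_. 0" p f z] by (simp add: ev_def L_def flip: Lh)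
      then have "z = 0" using p by (simp add: poly_eval_form_scale[OF form])
      then show ?thesis using z ev.poly_map_poly[of P 0] by (simp add: ev_def)
    qed
    have "f = poly L 0" by (simp add: L_def)
    also have "\<dots> = (Const \<epsilon> * poly P 0) * poly Q 0" by (simp add: Lh flip: PQ)
    finally have "Const \<epsilon> * poly P 0 dvd 1 \<or> poly Q 0 dvd 1"
      using irr irreducibleD by blast
    then show False
      using root[OF PQ] root[of Q P] PQ degPQ poly_eval_unit[of _ "\<lambda>_. 0"]
      by (auto simp: mult.commute poly_eval.hom_mult dest: poly_eval_unit[of _ "\<lambda>_. 0"])
  qed
qed

text \<open>The finitely many \<open>g\<close> are handled through one product \<open>G\<close>;
  primality of f(x + T p) over the fraction field then singles out a factor.\<close>

theorem irreducible_form_dvd_of_zeros_covered: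
  fixes f :: "('i::linorder, 'a::alg_closed_field) mpoly"
  assumes form: "is_form I d f" and "d > 0" and irr: "irreducible f" and "finite S"
    and cover: "\<And>v. poly_eval f v = 0 \<Longrightarrow> \<exists>g\<in>S. poly_eval g v = 0"
  shows "\<exists>g\<in>S. f dvd g"
proof -
  have "f \<noteq> 0" using irr by auto
  then obtain p where p: "poly_eval f p \<noteq> 0"
    using poly_eval_nonzero[OF infinite_UNIV_alg_closed] by blast
  define L where "L = line_poly p f"
  define G where "G = (\<Prod>g\<in>S. line_poly p g)"
  have degL: "degree L = d" and lcL: "lead_coeff L = Const (poly_eval f p)"
    using degree_line_poly[OF form p] by (auto simp: L_def)
  have prime: "prime_elem (fract_poly L)"
    unfolding L_def
    by (intro field_poly_irreducible_imp_prime irreducible_fract_line_poly) (use assms p in auto)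
  have "fract_poly L dvd fract_poly G"
  proof (rule ccontr)
    assume "\<not> fract_poly L dvd fract_poly G"
    then obtain u v where uv: "u * fract_poly L + v * fract_poly G = 1"
      using prime_elem_bezout[OF prime] by blast
    \<comment> \<open>Clearing denominators gives a Bezout identity over the polynomial ring, with
      \<alpha> \<beta> in place of 1.\<close>
    obtain \<alpha> U where U: "\<alpha> \<noteq> 0" "smult (to_fract \<alpha>) u = fract_poly U" by (rule clear_denominators)
    obtain \<beta> V where V: "\<beta> \<noteq> 0" "smult (to_fract \<beta>) v = fract_poly V" by (rule clear_denominators)
    have "fract_poly (smult \<beta> U * L + smult \<alpha> V * G) =
        smult (to_fract (\<alpha> * \<beta>)) (u * fract_poly L + v * fract_poly G)"
      by (simp add: smult_add_right ac_simps flip: U(2) V(2))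
    also have "\<dots> = fract_poly [:\<alpha> * \<beta>:]" by (simp add: uv map_poly_pCons)
    finally have eq: "smult \<beta> U * L + smult \<alpha> V * G = [:\<alpha> * \<beta>:]" by (simp only: fract_poly_eq_iff)
    have "\<alpha> * \<beta> \<noteq> 0" using U V by simp
    then obtain w where w: "poly_eval (\<alpha> * \<beta>) w \<noteq> 0"
      using poly_eval_nonzero[OF infinite_UNIV_alg_closed] by blast
    define ev where "ev = (\<lambda>a :: ('i, 'a) mpoly. poly_eval a w)"
    interpret ev: ring_hom_0 ev unfolding ev_def by (rule poly_eval_hom)
    interpret mev: ring_hom_0 "map_poly ev" by (rule ev.map_poly_hom)
    \<comment> \<open>The leading coefficient of \<open>L\<close> is a nonzero constant, so
      \<open>L\<close> keeps degree \<open>d\<close> at \<open>w\<close> and has a root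
      \<open>z\<close>. There \<open>f\<close> and with it some \<open>g\<close> vanish, whereas
      \<alpha> \<beta> does not vanish at \<open>w\<close>.\<close>
    have "coeff (map_poly ev L) d \<noteq> 0" using p degL lcL by (simp add: coeff_map_poly ev_def)
    then have "degree (map_poly ev L) > 0" using \<open>d > 0\<close> le_degree by (metis order.strict_trans2)
    then obtain z where z: "poly (map_poly ev L) z = 0" using alg_closed_imp_poly_has_root by blast
    then have "poly_eval f (\<lambda>i. w i + z * p i) = 0"
      by (simp add: L_def ev_def poly_map_line_poly)
    then obtain g where g: "g \<in> S" "poly_eval g (\<lambda>i. w i + z * p i) = 0" using cover by blast
    have "poly (map_poly ev G) z = (\<Prod>g\<in>S. poly_eval g (\<lambda>i. w i + z * p i))"
      by (simp add: G_def mev.hom_prod poly_prod) (simp add: ev_def poly_map_line_poly)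
    also have "\<dots> = 0" using g \<open>finite S\<close> by auto
    finally have "poly (map_poly ev (smult \<beta> U * L + smult \<alpha> V * G)) z = 0"
      using z by (simp add: mev.hom_add mev.hom_mult del: mult_smult_left)
    then have "ev (\<alpha> * \<beta>) = 0" unfolding eq by (simp add: map_poly_pCons)
    then show False using w by (simp add: ev_def)
  qed
  moreover have "fract_poly G = (\<Prod>g\<in>S. fract_poly (line_poly p g))"
    unfolding G_def by (rule ring_hom_0.hom_prod[OF to_fract.map_poly_hom])
  ultimately have "\<exists>g\<in>S. fract_poly L dvd fract_poly (line_poly p g)"
    using prime \<open>finite S\<close> by (auto dest: prime_elem_dvd_prod)
  \<comment> \<open>As the leading coefficient of \<open>L\<close> is a unit, divisibility descends
    from the fraction field; T = 0 turns it into divisibility by \<open>f\<close>.\<close>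
  then obtain g where g: "g \<in> S" "L dvd line_poly p g"
    using dvd_of_fract_poly_dvd lcL is_unit_Const[OF p] by metis
  then have "poly L 0 dvd poly (line_poly p g) 0" by (metis dvdE dvd_triv_left poly_mult)
  then show ?thesis using g by (auto simp: L_def)
qed

section \<open>Forms and product rank\<close>

lemma mdeg_superset:
  "finite S \<Longrightarrow> Poly_Mapping.keys m \<subseteq> S \<Longrightarrow> mdeg m = (\<Sum>i\<in>S. Poly_Mapping.lookup m i)"
  unfolding mdeg_def by (rule sum.mono_neutral_left) (auto simp: in_keys_iff)

lemma mdeg_add: "mdeg (m + m') = mdeg m + mdeg m'"
proof -
  let ?S = "Poly_Mapping.keys m \<union> Poly_Mapping.keys m'"
  have "mdeg (m + m') = (\<Sum>i\<in>?S. Poly_Mapping.lookup (m + m') i)"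
    by (rule mdeg_superset) (auto dest: subsetD[OF keys_add])
  also have "\<dots> = mdeg m + mdeg m'"
    by (simp add: mdeg_superset[of ?S] lookup_add sum.distrib)
  finally show ?thesis .
qed

lemma mdeg_single [simp]: "mdeg (Poly_Mapping.single i k) = k"
  by (simp add: mdeg_def)

lemma mdeg_0 [simp]: "mdeg 0 = 0"
  by (simp add: mdeg_def)

lemma mdeg_eq_0_iff [simp]: "mdeg m = 0 \<longleftrightarrow> m = 0"
  by (auto simp: mdeg_def in_keys_iff intro!: poly_mapping_eqI)

lemma mdeg_SucE:
  assumes "mdeg m = Suc k"
  obtains i m' where "m = m' + Poly_Mapping.single i 1" "mdeg m' = k"
proof -
  have "m \<noteq> 0" using assms by auto
  then obtain i where i: "Poly_Mapping.lookup m i \<noteq> 0" by (metis lookup_zero poly_mapping_eqI)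
  define m' where "m' = Poly_Mapping.update i (Poly_Mapping.lookup m i - 1) m"
  have m: "m = m' + Poly_Mapping.single i 1"
    by (rule poly_mapping_eqI) (use i in \<open>auto simp: m'_def lookup_add lookup_update lookup_single when_def\<close>)
  then have "mdeg m' = k" using assms by (simp add: mdeg_add)
  with m show thesis by (rule that)
qed

lemma is_form_single: "Poly_Mapping.keys m \<subseteq> I \<Longrightarrow> mdeg m = d \<Longrightarrow> is_form I d (Poly_Mapping.single m c)"
  by (auto simp: is_form_def vars_def split: if_splits)

lemma is_form_0 [simp]: "is_form I d 0"
  by (simp add: is_form_def)

lemma is_form_add: "is_form I d f \<Longrightarrow> is_form I d g \<Longrightarrow> is_form I d (f + g)"
  using vars_add[of f g] keys_add[of f g] unfolding is_form_def by blast

lemma is_form_sum: "(\<And>x. x \<in> A \<Longrightarrow> is_form I d (g x)) \<Longrightarrow> is_form I d (sum g A)"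
  by (induction A rule: infinite_finite_induct) (auto intro: is_form_add)

lemma is_form_mult:
  assumes "is_form I d f" "is_form I e g"
  shows "is_form I (d + e) (f * g)"
  unfolding is_form_def
proof (intro conjI ballI)
  show "vars (f * g) \<subseteq> I" using assms vars_mult[of f g] by (auto simp: is_form_def)
  fix m assume "m \<in> Poly_Mapping.keys (f * g)"
  then obtain a b where "m = a + b" "a \<in> Poly_Mapping.keys f" "b \<in> Poly_Mapping.keys g"
    using keys_mult[of f g] by auto
  then show "mdeg m = d + e" using assms by (auto simp: is_form_def mdeg_add)
qed

lemma is_form_Const: "is_form I 0 (Const c)"
  unfolding Const_def by (rule is_form_single) auto

lemma is_form_prod:
  "finite A \<Longrightarrow> (\<And>x. x \<in> A \<Longrightarrow> is_form I 1 (g x)) \<Longrightarrow> is_form I (card A) (prod g A)"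
proof (induction A rule: finite_induct)
  case empty
  then show ?case using is_form_Const[of I 1] by simp
next
  case (insert x A)
  then show ?case using is_form_mult[of I 1 "g x" "card A" "prod g A"] by simp
qed

lemma poly_eval_form_0:
  assumes "is_form I d f" "d > 0"
  shows "poly_eval f (\<lambda>_. 0) = 0"
  using poly_eval_form_scale[OF assms(1), of 0 "\<lambda>_. 0"] assms(2) by (simp add: zero_power)

text \<open>Along a direction with f(p) nonzero the quotient has degree 0 in T; comparing
  coefficients of T^d then shows that it is a constant.\<close>

lemma form_dvd_form:
  fixes f g :: "('i::linorder, 'a::alg_closed_field) mpoly"
  assumes f: "is_form I d f" "f \<noteq> 0" and g: "is_form I d g" and "f dvd g"
  obtains c where "g = Const c * f"
proof -
  obtain h where h: "g = f * h" using \<open>f dvd g\<close> by blast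
  obtain p where p: "poly_eval f p \<noteq> 0"
    using poly_eval_nonzero[OF infinite_UNIV_alg_closed] f by blast
  note L = degree_line_poly[OF f(1) p]
  have nz: "line_poly p f \<noteq> 0" using L p by auto
  have "degree (line_poly p h) = 0"
  proof (cases "line_poly p h = 0")
    case False
    have "degree (line_poly p g) = d + degree (line_poly p h)"
      using False nz L by (simp add: h line_poly.hom_mult degree_mult_eq)
    then show ?thesis using line_poly_form(1)[OF g, of p] by simp
  qed simp
  then have "line_poly p h = [:h:]" by (metis degree_eq_zeroE poly_const_conv poly_line_poly_0)
  then have "coeff (line_poly p g) d = Const (poly_eval f p) * h"
    using L by (simp add: h line_poly.hom_mult)
  then have "Const (poly_eval f p) * h = Const (poly_eval g p)"
    by (simp add: line_poly_form(2)[OF g])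
  then have "Const (1 / poly_eval f p) * (Const (poly_eval f p) * h) =
      Const (1 / poly_eval f p) * Const (poly_eval g p)" by simp
  then have "h = Const (poly_eval g p / poly_eval f p)"
    using p by (simp flip: mult.assoc Const_hom.hom_mult)
  then show thesis using that[of "poly_eval g p / poly_eval f p"] h by (metis mult.commute)
qed

section \<open>Decompositions into products of linear forms\<close>

lemma product_rank_le:
  assumes "finite A" "\<And>i j. i \<in> A \<Longrightarrow> j \<in> {1..d} \<Longrightarrow> is_form I 1 (l i j)"
    and "f = (\<Sum>i\<in>A. \<Prod>j\<in>{1..d}. l i j)"
  shows "product_rank I d f \<le> card A"
proof -
  \<comment> \<open>Later arguments delete or select summands, so \<open>A\<close> is an arbitrary
    finite set and \<open>b\<close> renumbers it.\<close>
  obtain b where b: "bij_betw b {1..card A} A"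
    using ex_bij_betw_nat_finite_1[OF assms(1)] by blast
  have "f = (\<Sum>i\<in>{1..card A}. \<Prod>j\<in>{1..d}. l (b i) j)"
    unfolding assms(3) by (rule sum.reindex_bij_betw[OF b, symmetric])
  moreover have "b i \<in> A" if "i \<in> {1..card A}" for i using b that by (auto simp: bij_betw_def)
  ultimately show ?thesis
    unfolding product_rank_def
    by (intro Least_le exI[of _ "\<lambda>i. l (b i)"]) (use assms(2) in auto)
qed

lemma monomial_eq_prod_forms:
  assumes "mdeg m = Suc k" "Poly_Mapping.keys m \<subseteq> I"
  shows "\<exists>l. (\<forall>j\<in>{1..Suc k}. is_form I 1 (l j)) \<and>
    Poly_Mapping.single m c = (\<Prod>j\<in>{1..Suc k}. l j)"
  using assms
proof (induction k arbitrary: m)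
  case 0
  then show ?case
    by (intro exI[of _ "\<lambda>_. Poly_Mapping.single m c"]) (auto intro: is_form_single)
next
  case (Suc k)
  then obtain i m' where m: "m = m' + Poly_Mapping.single i 1" "mdeg m' = Suc k"
    by (auto elim: mdeg_SucE)
  have keys: "Poly_Mapping.keys m' \<subseteq> I" "i \<in> I"
    using Suc.prems by (auto simp: m in_keys_iff lookup_add subset_iff)
  then obtain l where l: "\<forall>j\<in>{1..Suc k}. is_form I 1 (l j)"
      "Poly_Mapping.single m' c = (\<Prod>j\<in>{1..Suc k}. l j)"
    using Suc.IH m by blast
  have "is_form I 1 (Var i)" using keys unfolding Var_def by (intro is_form_single) auto
  moreover have "Poly_Mapping.single m c = Poly_Mapping.single m' c * Var i"
    by (simp add: m Var_def mult_single)
  moreover have "(\<Prod>j\<in>{1..Suc k}. (l(Suc (Suc k) := Var i)) j) = (\<Prod>j\<in>{1..Suc k}. l j)"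
    by (intro prod.cong) auto
  ultimately show ?case using l
    by (intro exI[of _ "l(Suc (Suc k) := Var i)"]) (auto simp: le_Suc_eq)
qed

text \<open>The monomials of \<open>f\<close> give one decomposition, so the least number exists and
  is attained.\<close>

lemma product_rank_attained:
  assumes "is_form I d f" "d > 0"
  obtains l where "\<And>i j. i \<in> {1..product_rank I d f} \<Longrightarrow> j \<in> {1..d} \<Longrightarrow> is_form I 1 (l i j)"
    and "f = (\<Sum>i\<in>{1..product_rank I d f}. \<Prod>j\<in>{1..d}. l i j)"
proof -
  let ?D = "\<lambda>r. \<exists>l :: nat \<Rightarrow> nat \<Rightarrow> _. (\<forall>i\<in>{1..r}. \<forall>j\<in>{1..d}. is_form I 1 (l i j)) \<and>
        f = (\<Sum>i\<in>{1..r}. \<Prod>j\<in>{1..d}. l i j)"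
  obtain k where k: "d = Suc k" using assms(2) by (cases d) auto
  have "\<exists>l. (\<forall>j\<in>{1..d}. is_form I 1 (l j)) \<and>
      Poly_Mapping.single m (Poly_Mapping.lookup f m) = (\<Prod>j\<in>{1..d}. l j)"
    if "m \<in> Poly_Mapping.keys f" for m
    unfolding k using assms(1) that
    by (intro monomial_eq_prod_forms) (auto simp: k is_form_def vars_def)
  then obtain l where l: "\<And>m. m \<in> Poly_Mapping.keys f \<Longrightarrow> (\<forall>j\<in>{1..d}. is_form I 1 (l m j)) \<and>
      Poly_Mapping.single m (Poly_Mapping.lookup f m) = (\<Prod>j\<in>{1..d}. l m j)"
    by metis
  obtain b where b: "bij_betw b {1..card (Poly_Mapping.keys f)} (Poly_Mapping.keys f)"
    using ex_bij_betw_nat_finite_1[of "Poly_Mapping.keys f"] by auto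
  have bi: "b i \<in> Poly_Mapping.keys f" if "i \<in> {1..card (Poly_Mapping.keys f)}" for i
    using b that by (auto simp: bij_betw_def)
  have "f = (\<Sum>m\<in>Poly_Mapping.keys f. Poly_Mapping.single m (Poly_Mapping.lookup f m))"
    by (rule mpoly_eq_sum_single)
  also have "\<dots> = (\<Sum>m\<in>Poly_Mapping.keys f. \<Prod>j\<in>{1..d}. l m j)" using l by (intro sum.cong) auto
  also have "\<dots> = (\<Sum>i\<in>{1..card (Poly_Mapping.keys f)}. \<Prod>j\<in>{1..d}. l (b i) j)"
    by (rule sum.reindex_bij_betw[OF b, symmetric])
  finally have "?D (card (Poly_Mapping.keys f))"
    using l bi by (intro exI[of _ "\<lambda>i. l (b i)"]) blast
  then have "?D (product_rank I d f)" unfolding product_rank_def by (rule LeastI)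
  then show thesis using that by blast
qed

section \<open>Linear forms and conciseness\<close>

lemma linear_form_eq:
  fixes L :: "('i, 'a::comm_semiring_1) mpoly"
  assumes "is_form I 1 L" "finite I"
  obtains c where "L = (\<Sum>i\<in>I. Const (c i) * Var i)"
proof -
  define c where "c = (\<lambda>i. Poly_Mapping.lookup L (Poly_Mapping.single i 1))"
  have "Poly_Mapping.keys L \<subseteq> (\<lambda>i. Poly_Mapping.single i 1) ` I"
  proof
    fix m assume m: "m \<in> Poly_Mapping.keys L"
    then have "mdeg m = Suc 0" "Poly_Mapping.keys m \<subseteq> I"
      using assms(1) by (auto simp: is_form_def vars_def)
    then show "m \<in> (\<lambda>i. Poly_Mapping.single i 1) ` I" by (elim mdeg_SucE) auto
  qed
  have inj: "inj_on (\<lambda>i. Poly_Mapping.single i (1::nat)) I"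
    by (intro inj_onI) (metis lookup_single_eq lookup_single_not_eq zero_neq_one)
  have "L = (\<Sum>m\<in>Poly_Mapping.keys L. Poly_Mapping.single m (Poly_Mapping.lookup L m))"
    by (rule mpoly_eq_sum_single)
  also have "\<dots> = (\<Sum>m\<in>(\<lambda>i. Poly_Mapping.single i 1) ` I. Poly_Mapping.single m (Poly_Mapping.lookup L m))"
    by (rule sum.mono_neutral_left) (use assms \<open>Poly_Mapping.keys L \<subseteq> _\<close> in \<open>auto simp: in_keys_iff\<close>)
  also have "\<dots> = (\<Sum>i\<in>I. Const (c i) * Var i)"
    by (subst sum.reindex[OF inj]) (simp add: c_def Const_def Var_def mult_single)
  finally show thesis by (rule that)
qed

lemma poly_eval_linear_form:
  "poly_eval (\<Sum>i\<in>I. Const (c i) * Var i) v = (\<Sum>i\<in>I. c i * v i)"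
  by (simp add: poly_eval.hom_sum poly_eval.hom_mult)

lemma linear_subst_conv_aeval:
  "linear_subst I A f = Const_hom.aeval (\<lambda>i. \<Sum>j\<in>I. Const (A i j) * Var j) f"
  by (simp add: linear_subst_def Const_hom.aeval_def mono_eval_def)

text \<open>In coordinates where \<open>v\<close> is a basis vector, every linear form vanishing at
  \<open>v\<close> loses the corresponding variable; if all \<open>l i j\<close> do, so does
  \<open>f\<close>.\<close>

lemma concise_imp_no_common_zero:
  fixes f :: "('i, 'a::field) mpoly" and l :: "nat \<Rightarrow> nat \<Rightarrow> ('i, 'a) mpoly"
  assumes con: "concise I f" and "finite I"
    and l: "\<And>i j. i \<in> A \<Longrightarrow> j \<in> B \<Longrightarrow> is_form I 1 (l i j)"
    and f: "f = (\<Sum>i\<in>A. \<Prod>j\<in>B. l i j)"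
    and v: "v \<in> coord_space I" "\<And>i j. i \<in> A \<Longrightarrow> j \<in> B \<Longrightarrow> poly_eval (l i j) v = 0"
  shows "v = 0"
proof (rule ccontr)
  assume "v \<noteq> 0"
  then obtain k where k: "v k \<noteq> 0" by (auto simp: fun_eq_iff)
  then have kI: "k \<in> I" using v by (auto simp: coord_space_def)
  \<comment> \<open>\<open>M\<close> is the identity with column \<open>k\<close> replaced by
    \<open>v\<close>, and \<open>N\<close> is its inverse, which exists because \<open>v k\<close>
    is nonzero.\<close>
  define M where "M = (\<lambda>i j. if j = k then v i else if i = j then 1 else 0)"
  define N where "N = (\<lambda>i j. if j = k then if i = k then 1 / v k else - v i / v k else if i = j then 1 else 0)"
  have sum_split: "(\<Sum>m\<in>I. g m) = g k + (\<Sum>m\<in>I - {k}. g m)" for g :: "'i \<Rightarrow> 'a"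
    using kI \<open>finite I\<close> by (simp add: sum.remove)
  have inv1: "(\<Sum>m\<in>I. M i m * N m j) = (if i = j then 1 else 0)" if "i \<in> I" "j \<in> I" for i j
  proof -
    have "(\<Sum>m\<in>I - {k}. M i m * N m j) = (\<Sum>m\<in>I - {k}. if m = i then N m j else 0)"
      by (intro sum.cong) (auto simp: M_def)
    also have "\<dots> = (if i = k then 0 else N i j)" using \<open>finite I\<close> that by (auto simp: sum.delta)
    finally show ?thesis unfolding sum_split using k by (auto simp: M_def N_def)
  qed
  have inv2: "(\<Sum>m\<in>I. N i m * M m j) = (if i = j then 1 else 0)" if "i \<in> I" "j \<in> I" for i j
  proof -
    have "(\<Sum>m\<in>I - {k}. N i m * M m j) = (\<Sum>m\<in>I - {k}. if m = i then M m j else 0)"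
      by (intro sum.cong) (auto simp: N_def)
    also have "\<dots> = (if i = k then 0 else M i j)" using \<open>finite I\<close> that by (auto simp: sum.delta)
    finally show ?thesis unfolding sum_split using k by (auto simp: M_def N_def)
  qed
  have "inverse_matrices I M N" using inv1 inv2 by (simp add: inverse_matrices_def)
  interpret sub: ring_hom_0 "linear_subst I M :: ('i, 'a) mpoly \<Rightarrow> ('i, 'a) mpoly"
    unfolding linear_subst_conv_aeval[abs_def] by (rule Const_hom.aeval_hom)
  have lin: "vars (linear_subst I M L) \<subseteq> I - {k}" if L: "is_form I 1 L" "poly_eval L v = 0" for L
  proof -
    obtain c where c: "L = (\<Sum>i\<in>I. Const (c i) * Var i)"
      using linear_form_eq[OF L(1) \<open>finite I\<close>] by blast
    have "linear_subst I M L = (\<Sum>i\<in>I. Const (c i) * (\<Sum>j\<in>I. Const (M i j) * Var j))"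
      by (simp add: c sub.hom_sum sub.hom_mult) (simp add: linear_subst_conv_aeval)
    also have "\<dots> = (\<Sum>i\<in>I. \<Sum>j\<in>I. Const (c i * M i j) * Var j)"
      by (simp add: sum_distrib_left mult.assoc Const_hom.hom_mult)
    also have "\<dots> = (\<Sum>j\<in>I. \<Sum>i\<in>I. Const (c i * M i j) * Var j)" by (rule sum.swap)
    also have "\<dots> = (\<Sum>j\<in>I. Const (\<Sum>i\<in>I. c i * M i j) * Var j)"
      by (simp add: sum_distrib_right Const_hom.hom_sum)
    finally have eq: "linear_subst I M L = (\<Sum>j\<in>I. Const (\<Sum>i\<in>I. c i * M i j) * Var j)" .
    \<comment> \<open>The coefficient of \<open>Var k\<close> after the substitution is the value of
      \<open>L\<close> at \<open>v\<close>.\<close>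
    have "(\<Sum>i\<in>I. c i * M i k) = 0" using L(2) by (simp add: c poly_eval_linear_form M_def)
    then show ?thesis unfolding eq
      by (intro vars_sum) (use vars_mult in fastforce)
  qed
  have "linear_subst I M f = (\<Sum>i\<in>A. \<Prod>j\<in>B. linear_subst I M (l i j))"
    by (simp add: f sub.hom_sum sub.hom_prod)
  also have "vars \<dots> \<subseteq> I - {k}" by (intro vars_sum vars_prod lin) (use l v in auto)
  finally have "vars (linear_subst I M f) \<subset> I" using kI by blast
  then show False using con \<open>inverse_matrices I M N\<close> unfolding concise_def by blast
qed

section \<open>Planes in the zero set\<close>

lemma fun_sum_apply: "(sum g A) x = (\<Sum>i\<in>A. g i x)"
  for g :: "'b \<Rightarrow> 'c \<Rightarrow> 'd::comm_monoid_add"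
  by (induction A rule: infinite_finite_induct) (auto simp: zero_fun_def plus_fun_def)

lemma subspace_coord_space: "fun_space.subspace (coord_space I :: ('i \<Rightarrow> 'a::field) set)"
  by (auto simp: fun_space.subspace_def coord_space_def fscale_def)

lemma dim_line:
  fixes v :: "'i \<Rightarrow> 'a::field"
  assumes "v \<noteq> 0"
  shows "fun_space.dim (fun_space.span {v}) = 1"
  using assms by (subst fun_space.dim_span_eq_card_independent) auto

lemma line_in_projectivization:
  fixes v :: "'i \<Rightarrow> 'a::field"
  assumes "fun_space.subspace W" "v \<in> W" "v \<noteq> 0"
  shows "fun_space.span {v} \<in> projectivization W"
  using assms dim_line[of v] by (auto simp: projectivization_def intro: fun_space.span_minimal[THEN subsetD])

lemma line_in_proj_zeros:
  fixes f :: "('i, 'a::field) mpoly"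
  assumes "is_form I d f" "v \<in> coord_space I" "v \<noteq> 0" "poly_eval f v = 0"
  shows "fun_space.span {v} \<in> proj_zeros I f"
proof -
  have "poly_eval f w = 0" if w: "w \<in> fun_space.span {v}" for w
  proof -
    obtain z where z: "w = fscale z v" using w by (auto simp: fun_space.span_singleton)
    show ?thesis using poly_eval_form_scale[OF assms(1), of z v] assms(4) by (simp add: z fscale_def)
  qed
  then show ?thesis
    using line_in_projectivization[OF subspace_coord_space assms(2,3)]
    by (auto simp: proj_zeros_def proj_space_def)
qed

lemma covered_by_planes_subspace:
  fixes f :: "('i, 'a::field) mpoly"
  assumes "covered_by_planes I k (proj_zeros I f)" and f: "is_form I d f" "d > 0"
    and v: "v \<in> coord_space I" "v \<noteq> 0" "poly_eval f v = 0"
  obtains W where "fun_space.subspace W" "W \<subseteq> coord_space I" "int (fun_space.dim W) = k + 1"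
    "v \<in> W" "\<And>w. w \<in> W \<Longrightarrow> poly_eval f w = 0"
proof -
  obtain L where L: "L \<in> fano I k (proj_zeros I f)" "fun_space.span {v} \<in> L"
    using assms(1) line_in_proj_zeros[OF f(1) v] unfolding covered_by_planes_def by blast
  then obtain W where W: "fun_space.subspace W" "W \<subseteq> coord_space I" "int (fun_space.dim W) = k + 1"
      "L = projectivization W" "L \<subseteq> proj_zeros I f"
    unfolding fano_def is_plane_def by blast
  have "v \<in> W" using L(2) W(4) fun_space.span_base[of v "{v}"] by (auto simp: projectivization_def)
  moreover have "poly_eval f w = 0" if "w \<in> W" for w
  \<comment> \<open>The zero vector spans no projective point and needs its own argument.\<close>
  proof (cases "w = 0")
    case True
    then show ?thesis using poly_eval_form_0[OF f] by (simp add: zero_fun_def)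
  next
    case False
    then have "fun_space.span {w} \<in> proj_zeros I f"
      using line_in_projectivization[OF W(1) that] W(4,5) by blast
    then show ?thesis using fun_space.span_base[of w "{w}"] by (auto simp: proj_zeros_def)
  qed
  ultimately show thesis using that W by blast
qed

lemma dim_image_inj_on:
  fixes \<phi> :: "('i \<Rightarrow> 'a::field) \<Rightarrow> ('j \<Rightarrow> 'a)"
  assumes "Vector_Spaces.linear fscale fscale \<phi>" "fun_space.subspace W" "inj_on \<phi> W"
  shows "fun_space.dim (\<phi> ` W) = fun_space.dim W"
proof -
  interpret lin: Vector_Spaces.linear fscale fscale \<phi> by fact
  obtain B where B: "B \<subseteq> W" "fun_space.independent B" "W \<subseteq> fun_space.span B"
      "card B = fun_space.dim W"
    by (rule fun_space.basis_exists)
  have span: "fun_space.span B = W"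
    using B assms(2) by (simp add: fun_space.span_subspace)
  then have "fun_space.independent (\<phi> ` B)"
    using B assms(3) by (intro lin.independent_injective_image) auto
  moreover have "fun_space.span (\<phi> ` B) = fun_space.span (\<phi> ` W)"
    using lin.span_image[of B] lin.span_image[of W] span by (metis fun_space.span_span)
  ultimately have "fun_space.dim (\<phi> ` W) = card (\<phi> ` B)" by (intro fun_space.dim_eq_card)
  also have "\<dots> = card B" using B assms(3) by (intro card_image) (auto intro: inj_on_subset)
  finally show ?thesis using B by simp
qed

lemma poly_eval_sum_prod_Var:
  "poly_eval (\<Sum>i\<in>A. \<Prod>j\<in>B. Var (a i, j)) w = (\<Sum>i\<in>A. \<Prod>j\<in>B. w (a i, j))"
  by (simp add: poly_eval.hom_sum poly_eval.hom_prod)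

text \<open>The \<open>l i j\<close> form a linear map \<phi>, injective by conciseness, which
  carries a plane through \<open>v\<close> to a plane in \<open>X_hyp r d\<close>; its splitting is
  read off at the image of \<open>v\<close>.\<close>

lemma fano_split_zeros:
  fixes f :: "('i, 'a::field) mpoly" and l :: "nat \<Rightarrow> nat \<Rightarrow> ('i, 'a) mpoly"
  assumes split: "fano_split TYPE('a) m k r d"
    and cov: "covered_by_planes I k (proj_zeros I f)" and form: "is_form I d f" and "d > 0" "finite I"
    and con: "concise I f"
    and l: "\<And>i j. i \<in> {1..r} \<Longrightarrow> j \<in> {1..d} \<Longrightarrow> is_form I 1 (l i j)"
    and f: "f = (\<Sum>i\<in>{1..r}. \<Prod>j\<in>{1..d}. l i j)"
    and v: "v \<in> coord_space I" "v \<noteq> 0" "poly_eval f v = 0"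
  shows "\<exists>A. A \<subseteq> {1..r} \<and> A \<noteq> {} \<and> card A \<le> m \<and> poly_eval (\<Sum>i\<in>A. \<Prod>j\<in>{1..d}. l i j) v = 0"
proof -
  define \<phi> :: "('i \<Rightarrow> 'a) \<Rightarrow> nat \<times> nat \<Rightarrow> 'a" where
    "\<phi> = (\<lambda>v (i, j). if (i, j) \<in> X_index r d then poly_eval (l i j) v else 0)"
  have \<phi>: "\<phi> v (i, j) = poly_eval (l i j) v" if "i \<in> {1..r}" "j \<in> {1..d}" for v i j
    using that by (simp add: \<phi>_def X_index_def)
  have \<phi>_coord: "\<phi> v \<in> coord_space (X_index r d)" for v
    by (auto simp: coord_space_def \<phi>_def)
  have lin: "Vector_Spaces.linear fscale fscale \<phi>"
  proof
    have *: "poly_eval (l i j) (v + w) = poly_eval (l i j) v + poly_eval (l i j) w \<and>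
        poly_eval (l i j) (fscale z v) = z * poly_eval (l i j) v"
      if ij: "i \<in> {1..r}" "j \<in> {1..d}" for i j v w z
    proof -
      obtain c where c: "l i j = (\<Sum>i\<in>I. Const (c i) * Var i)"
        using linear_form_eq[OF l[OF ij] \<open>finite I\<close>] by blast
      show ?thesis
        by (simp add: c poly_eval_linear_form plus_fun_def fscale_def distrib_left sum.distrib
            sum_distrib_left mult.left_commute)
    qed
    show "\<phi> (v + w) = \<phi> v + \<phi> w" for v w
      using * by (auto simp: \<phi>_def X_index_def plus_fun_def fun_eq_iff)
    show "\<phi> (fscale z v) = fscale z (\<phi> v)" for z v
      using * by (auto simp: \<phi>_def X_index_def fscale_def fun_eq_iff)
  qed
  interpret lin: Vector_Spaces.linear fscale fscale \<phi> by (rule lin)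
  have ker: "w = 0" if "w \<in> coord_space I" "\<phi> w = 0" for w
    using \<phi>[of _ _ w] that(2)
    by (intro concise_imp_no_common_zero[OF con \<open>finite I\<close> l f that(1)]) (auto simp: zero_fun_def)
  obtain W where W: "fun_space.subspace W" "W \<subseteq> coord_space I" "int (fun_space.dim W) = k + 1"
      "v \<in> W" "\<And>w. w \<in> W \<Longrightarrow> poly_eval f w = 0"
    using covered_by_planes_subspace[OF cov form \<open>d > 0\<close> v] by blast
  have inj: "inj_on \<phi> W" using ker W by (subst lin.inj_on_iff_eq_0) auto
  define L where "L = projectivization (\<phi> ` W)"
  have sub: "fun_space.subspace (\<phi> ` W)" by (rule lin.subspace_image[OF W(1)])
  have coord: "\<phi> ` W \<subseteq> coord_space (X_index r d)" using \<phi>_coord by auto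
  have zero: "poly_eval (\<Sum>i\<in>{1..r}. \<Prod>j\<in>{1..d}. Var (i, j)) (\<phi> w) = 0" if "w \<in> W" for w
  proof -
    \<comment> \<open>Pulling back the equation of \<open>X_hyp r d\<close> along \<phi> gives
      \<open>f\<close>.\<close>
    have "poly_eval (\<Sum>i\<in>{1..r}. \<Prod>j\<in>{1..d}. Var (i, j)) (\<phi> w) = poly_eval f w"
      by (simp add: poly_eval_sum_prod_Var \<phi> f poly_eval.hom_sum poly_eval.hom_prod)
    then show ?thesis using W that by simp
  qed
  have "is_plane (X_index r d) k L"
    unfolding is_plane_def
    using sub coord W(3) dim_image_inj_on[OF lin W(1) inj] by (auto simp: L_def)
  moreover have "L \<subseteq> X_hyp r d"
    using coord zero
    by (auto simp: L_def X_hyp_def proj_zeros_def proj_space_def projectivization_def subset_iff)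
  ultimately have "L \<in> fano (X_index r d) k (X_hyp r d)" by (simp add: fano_def)
  then obtain s where s: "1 \<le> s" "s \<le> m" "admits_splitting r d s L"
    using split unfolding fano_split_def by blast
  then obtain a where a: "strict_mono_on {1..s} a" "a ` {1..s} \<subseteq> {1..r}"
      "L \<subseteq> proj_zeros (X_index r d) (\<Sum>i\<in>{1..s}. \<Prod>j\<in>{1..d}. Var (a i, j))"
    unfolding admits_splitting_def by blast
  have "\<phi> v \<noteq> 0" using ker v by auto
  then have "fun_space.span {\<phi> v} \<in> L"
    unfolding L_def using W by (intro line_in_projectivization[OF sub]) auto
  then have "poly_eval (\<Sum>i\<in>{1..s}. \<Prod>j\<in>{1..d}. Var (a i, j)) (\<phi> v) = 0"
    using a(3) fun_space.span_base[of "\<phi> v" "{\<phi> v}"] by (auto simp: proj_zeros_def)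
  then have "(\<Sum>i\<in>{1..s}. \<Prod>j\<in>{1..d}. poly_eval (l (a i) j) v) = 0"
    using a(2) by (simp add: poly_eval_sum_prod_Var \<phi> image_subset_iff)
  moreover have inja: "inj_on a {1..s}" using a(1) by (rule strict_mono_on_imp_inj_on)
  ultimately have "poly_eval (\<Sum>i\<in>a ` {1..s}. \<Prod>j\<in>{1..d}. l i j) v = 0"
    by (simp add: sum.reindex poly_eval.hom_sum poly_eval.hom_prod)
  moreover have "card (a ` {1..s}) \<le> m" using inja s by (simp add: card_image)
  ultimately show ?thesis using a(2) s(1) by (intro exI[of _ "a ` {1..s}"]) auto
qed

section \<open>Bounds on the product rank\<close>

lemma product_rank_le_of_fano_split:
  fixes f :: "('i::linorder, 'a::alg_closed_field) mpoly"
  assumes split: "fano_split TYPE('a) m k (product_rank I d f) d" and "m \<ge> 1"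
    and cov: "covered_by_planes I k (proj_zeros I f)" and form: "is_form I d f" and "d > 0" "finite I"
    and con: "concise I f" and irr: "irreducible f"
  shows "product_rank I d f \<le> m"
proof -
  define r where "r = product_rank I d f"
  obtain l where l: "\<And>i j. i \<in> {1..r} \<Longrightarrow> j \<in> {1..d} \<Longrightarrow> is_form I 1 (l i j)"
    and f: "f = (\<Sum>i\<in>{1..r}. \<Prod>j\<in>{1..d}. l i j)"
    using product_rank_attained[OF form \<open>d > 0\<close>] unfolding r_def by blast
  define g where "g = (\<lambda>A. \<Sum>i\<in>A. \<Prod>j\<in>{1..d}. l i j)"
  define S where "S = {A. A \<subseteq> {1..r} \<and> A \<noteq> {} \<and> card A \<le> m}"
  have "f \<noteq> 0" using irr by auto
  then have "r \<noteq> 0" using f by (intro notI) simp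
  have gform: "is_form I d (g A)" if "A \<in> S" for A
    unfolding g_def
  proof (intro is_form_sum)
    fix i assume "i \<in> A"
    then show "is_form I d (\<Prod>j\<in>{1..d}. l i j)"
      using is_form_prod[of "{1..d}" I "l i"] l that by (auto simp: S_def)
  qed
  have "\<exists>h\<in>g ` S. poly_eval h v = 0" if v: "poly_eval f v = 0" for v
  proof -
    \<comment> \<open>Points may have nonzero coordinates outside \<open>I\<close>; resetting these
      to 0 does not change the values of forms in the variables \<open>I\<close>.\<close>
    define v' where "v' = (\<lambda>i. if i \<in> I then v i else 0)"
    have v': "poly_eval h v = poly_eval h v'" if "is_form I d h" for h
      using that by (intro poly_eval_cong) (auto simp: is_form_def v'_def)
    have "\<exists>A\<in>S. poly_eval (g A) v' = 0"
    proof (cases "v' = 0")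
      case True
      \<comment> \<open>The origin is no projective point, but every form of positive degree
        vanishes there, so any member of \<open>S\<close> will do.\<close>
      have "{1} \<in> S" using \<open>m \<ge> 1\<close> \<open>r \<noteq> 0\<close> by (auto simp: S_def)
      then show ?thesis
        using poly_eval_form_0[OF gform \<open>d > 0\<close>] True by (auto simp: zero_fun_def)
    next
      case False
      have "v' \<in> coord_space I" by (auto simp: coord_space_def v'_def)
      then show ?thesis
        using fano_split_zeros[OF split[folded r_def] cov form \<open>d > 0\<close> \<open>finite I\<close> con l f, of v']
          False v v'[OF form] by (auto simp: S_def g_def)
    qed
    then show ?thesis using v' gform by fastforce
  qed
  moreover have "finite (g ` S)" by (rule finite_imageI, rule finite_subset[of _ "Pow {1..r}"]) (auto simp: S_def)
  ultimately obtain A where A: "A \<in> S" "f dvd g A"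
    using irreducible_form_dvd_of_zeros_covered[OF form \<open>d > 0\<close> irr, of "g ` S"] by blast
  obtain c where c: "g A = Const c * f" by (rule form_dvd_form[OF form \<open>f \<noteq> 0\<close> gform A(2)]) (use A in auto)
  have Ar: "A \<subseteq> {1..r}" "A \<noteq> {}" "card A \<le> m" "finite A"
    using A by (auto simp: S_def intro: finite_subset)
  \<comment> \<open>If \<open>g A\<close> were zero, the nonempty set \<open>A\<close> of summands
    could be deleted, against minimality of \<open>r\<close>.\<close>
  have "c \<noteq> 0"
  proof
    assume "c = 0"
    then have "g A = 0" using c by simp
    moreover have "f = g ({1..r} - A) + g A"
      unfolding f g_def using Ar by (intro sum.subset_diff) auto
    ultimately have "f = (\<Sum>i\<in>{1..r} - A. \<Prod>j\<in>{1..d}. l i j)" by (simp add: g_def)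
    then have "r \<le> card ({1..r} - A)" unfolding r_def by (intro product_rank_le) (use l r_def in auto)
    also have "\<dots> < r" using Ar \<open>r \<noteq> 0\<close> card_gt_0_iff[of A] by (simp add: card_Diff_subset)
    finally show False by simp
  qed
  \<comment> \<open>The factor 1/c goes into the first linear form of each product, which makes
    \<open>f\<close> a sum of \<open>card A\<close> products.\<close>
  define l' where "l' = (\<lambda>i j. if j = 1 then Const (1 / c) * l i j else l i j)"
  have prod1: "(\<Prod>j\<in>{1..d}. h j) = h 1 * (\<Prod>j\<in>{2..d}. h j)" for h :: "nat \<Rightarrow> ('i, 'a) mpoly"
    using \<open>d > 0\<close> by (simp add: prod.atLeast_Suc_atMost numeral_2_eq_2)
  have "f = Const (1 / c) * g A" using \<open>c \<noteq> 0\<close> by (simp add: c flip: mult.assoc Const_hom.hom_mult)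
  also have "\<dots> = (\<Sum>i\<in>A. \<Prod>j\<in>{1..d}. l' i j)"
    unfolding g_def sum_distrib_left
  proof (intro sum.cong refl)
    fix i
    have "(\<Prod>j\<in>{2..d}. l' i j) = (\<Prod>j\<in>{2..d}. l i j)" by (intro prod.cong) (auto simp: l'_def)
    then show "Const (1 / c) * (\<Prod>j\<in>{1..d}. l i j) = (\<Prod>j\<in>{1..d}. l' i j)"
      unfolding prod1 by (simp add: l'_def mult.assoc)
  qed
  finally have "r \<le> card A"
    unfolding r_def
  proof (intro product_rank_le[OF Ar(4)])
    fix i j assume "i \<in> A" "j \<in> {1..d}"
    then have "is_form I 1 (l i j)" using l Ar by auto
    then show "is_form I 1 (l' i j)"
      using is_form_mult[OF is_form_Const, of I 1 "l i j" "1 / c"] by (auto simp: l'_def)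
  qed
  then show ?thesis using Ar by (simp add: r_def)
qed

text \<open>Otherwise \<open>f\<close> is zero or a product of at least two linear forms; forms of
  positive degree vanish at the origin and so are not units.\<close>

lemma irreducible_form_product_rank_gt_1:
  fixes f :: "('i, 'a::field) mpoly"
  assumes "is_form I d f" "d > 1" "irreducible f"
  shows "product_rank I d f > 1"
proof (rule ccontr)
  assume "\<not> product_rank I d f > 1"
  moreover define r where "r = product_rank I d f"
  ultimately have r: "r \<le> 1" by simp
  obtain l where l: "\<And>i j. i \<in> {1..r} \<Longrightarrow> j \<in> {1..d} \<Longrightarrow> is_form I 1 (l i j)"
    and f: "f = (\<Sum>i\<in>{1..r}. \<Prod>j\<in>{1..d}. l i j)"
    using product_rank_attained[OF assms(1)] assms(2) unfolding r_def by auto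
  have "f \<noteq> 0" using assms(3) by auto
  then have "r \<noteq> 0" using f by (intro notI) simp
  with r have "r = 1" by simp
  then have "f = (\<Prod>j\<in>{1..d}. l 1 j)" using f by simp
  also have "\<dots> = l 1 1 * (\<Prod>j\<in>{2..d}. l 1 j)"
    using assms(2) by (simp add: prod.atLeast_Suc_atMost numeral_2_eq_2)
  finally have "l 1 1 dvd 1 \<or> (\<Prod>j\<in>{2..d}. l 1 j) dvd 1"
    using assms(3) irreducibleD by blast
  moreover have "is_form I 1 (l 1 1)" using l \<open>r = 1\<close> assms(2) by auto
  moreover have "is_form I (card {2..d}) (\<Prod>j\<in>{2..d}. l 1 j)"
    using l \<open>r = 1\<close> by (intro is_form_prod) auto
  ultimately show False
    using poly_eval_form_0[of I 1 "l 1 1"] poly_eval_form_0[of I "card {2..d}" "\<Prod>j\<in>{2..d}. l 1 j"]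
      poly_eval_unit[of _ "\<lambda>_. 0"] assms(2) by auto
qed

text \<open>Projection from a point \<open>p\<close> outside V(f) onto a hyperplane inside V(f) is x
  - m(x) p with \<open>m\<close> linear. So -m is a root of f(x + T p), and T + m is a proper factor
  of it.\<close>

lemma not_covered_by_hyperplanes:
  fixes f :: "('i::linorder, 'a::alg_closed_field) mpoly"
  assumes form: "is_form I d f" and "d > 1" and irr: "irreducible f" and "finite I"
    and cov: "covered_by_planes I k (proj_zeros I f)" and k: "k + 2 \<ge> int (card I)"
  shows False
proof -
  have "d > 0" using \<open>d > 1\<close> by simp
  have "f \<noteq> 0" using irr by auto
  then obtain p0 where p0: "poly_eval f p0 \<noteq> 0"
    using poly_eval_nonzero[OF infinite_UNIV_alg_closed] by blast
  define res where "res = (\<lambda>v i. if i \<in> I then v i else (0::'a))"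
  have res: "poly_eval f v = poly_eval f (res v)" for v
    using form by (intro poly_eval_cong) (auto simp: is_form_def res_def)
  have res_coord: "res v \<in> coord_space I" for v by (auto simp: coord_space_def res_def)
  define p where "p = res p0"
  have p: "poly_eval f p \<noteq> 0" "p \<in> coord_space I" using p0 res[of p0] res_coord by (auto simp: p_def)
  define e where "e = (\<lambda>i j :: 'i. if i = j then (1::'a) else 0)"
  have e_coord: "e i \<in> coord_space I" if "i \<in> I" for i using that by (auto simp: e_def coord_space_def)
  define L where "L = line_poly p f"
  note degL = degree_line_poly[OF form p(1), folded L_def]
  \<comment> \<open>In other words, \<open>W\<close> and \<open>p\<close> span the coordinate space;
    \<open>s\<close> is the coordinate of \<open>e i\<close> along \<open>p\<close>.\<close>
  have "\<exists>W. fun_space.subspace W \<and> (\<forall>w\<in>W. poly_eval f w = 0) \<and> (\<forall>i\<in>I. \<exists>s. e i - fscale s p \<in> W)"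
  proof (cases "\<exists>v\<in>coord_space I. v \<noteq> 0 \<and> poly_eval f v = 0")
    case True
    then obtain W where W: "fun_space.subspace W" "W \<subseteq> coord_space I" "int (fun_space.dim W) = k + 1"
        "\<And>w. w \<in> W \<Longrightarrow> poly_eval f w = 0" "W \<noteq> {0}"
      using covered_by_planes_subspace[OF cov form \<open>d > 0\<close>] by (metis singletonD)
    obtain B where B: "B \<subseteq> W" "fun_space.independent B" "W \<subseteq> fun_space.span B"
        "card B = fun_space.dim W"
      by (rule fun_space.basis_exists)
    have span: "fun_space.span B = W" using B W(1) by (simp add: fun_space.span_subspace)
    have spanE: "coord_space I \<subseteq> fun_space.span (e ` I)"
    proof
      fix v :: "'i \<Rightarrow> 'a" assume "v \<in> coord_space I"
      then have "v = (\<Sum>i\<in>I. fscale (v i) (e i))"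
        using \<open>finite I\<close> by (auto simp: fun_eq_iff fun_sum_apply fscale_def e_def coord_space_def if_distrib cong: if_cong)
      also have "\<dots> \<in> fun_space.span (e ` I)"
        by (intro fun_space.span_sum fun_space.span_scale fun_space.span_base) auto
      finally show "v \<in> fun_space.span (e ` I)" .
    qed
    have bound: "finite C \<and> card C \<le> card I" if "fun_space.independent C" "C \<subseteq> coord_space I"
      for C :: "('i \<Rightarrow> 'a) set"
      using fun_space.independent_span_bound[of "e ` I" C] that spanE \<open>finite I\<close> card_image_le[of I e]
      by fastforce
    have finB: "finite B" using bound[OF B(2)] B(1) W(2) by auto
    have pB: "p \<notin> fun_space.span B" using p W(4) span by auto
    then have ind: "fun_space.independent (insert p B)"
      using B by (simp add: fun_space.independent_insertI)
    have cardpB: "card (insert p B) = card B + 1"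
      using pB finB by (subst card_insert_disjoint) (auto dest: fun_space.span_base)
    have "\<exists>s. e i - fscale s p \<in> W" if "i \<in> I" for i
    proof -
      have "e i \<in> fun_space.span (insert p B)"
      proof (rule ccontr)
        \<comment> \<open>Then \<open>e i\<close>, \<open>p\<close> and \<open>B\<close> make up k +
          3 independent vectors, more than \<open>card I\<close>.\<close>
        assume *: "e i \<notin> fun_space.span (insert p B)"
        then have "fun_space.independent (insert (e i) (insert p B))"
          using ind by (simp add: fun_space.independent_insertI)
        then have "card (insert (e i) (insert p B)) \<le> card I"
          using bound p e_coord[OF that] B W by (metis insert_subset order.trans)
        moreover have "e i \<notin> insert p B" using * fun_space.span_base by blast
        then have "card (insert (e i) (insert p B)) = card B + 2"
          using finB cardpB by (subst card_insert_disjoint) auto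
        ultimately show False using k W(3) B(4) by linarith
      qed
      then show ?thesis using span by (simp add: fun_space.span_breakdown_eq)
    qed
    then show ?thesis using W by blast
  next
    \<comment> \<open>V(f) is empty here. The zero of \<open>f\<close> on the line through
      \<open>e i\<close> in direction \<open>p\<close> must be the zero vector, so
      \<open>e i\<close> is a multiple of \<open>p\<close> and \<open>{0}\<close> serves as
      \<open>W\<close>.\<close>
    case False
    have "\<exists>s. e i - fscale s p \<in> {0}" if "i \<in> I" for i
    proof -
      have "coeff (map_poly (\<lambda>a. poly_eval a (e i)) L) d \<noteq> 0" using degL p by (simp add: coeff_map_poly)
      then have "degree (map_poly (\<lambda>a. poly_eval a (e i)) L) > 0"
        using \<open>d > 0\<close> le_degree by (metis order.strict_trans2)
      then obtain z where "poly (map_poly (\<lambda>a. poly_eval a (e i)) L) z = 0"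
        using alg_closed_imp_poly_has_root by blast
      then have "poly_eval f (\<lambda>j. e i j + z * p j) = 0" by (simp add: L_def poly_map_line_poly)
      moreover have "(\<lambda>j. e i j + z * p j) \<in> coord_space I"
        using e_coord[OF that] p by (simp add: coord_space_def)
      ultimately have "(\<lambda>j. e i j + z * p j) = 0" using False by blast
      then have "e i - fscale (- z) p = 0" by (auto simp: fun_eq_iff fscale_def)
      then show ?thesis by blast
    qed
    moreover have "poly_eval f 0 = 0" using poly_eval_form_0[OF form \<open>d > 0\<close>] by (simp add: zero_fun_def)
    ultimately show ?thesis by (intro exI[of _ "{0}"]) auto
  qed
  then obtain W s where W: "fun_space.subspace W" "\<And>w. w \<in> W \<Longrightarrow> poly_eval f w = 0"
      "\<And>i. i \<in> I \<Longrightarrow> e i - fscale (s i) p \<in> W"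
    by metis
  define m where "m = (\<Sum>i\<in>I. Const (s i) * Var i)"
  have "poly L (- m) = 0"
  proof (rule mpoly_eqI)
    fix x
    define w where "w = (\<lambda>i. e i - fscale (s i) p)"
    have w: "w i y = e i y - s i * p y" for i y by (simp add: w_def fscale_def)
    have m: "poly_eval (- m) x = - (\<Sum>i\<in>I. s i * x i)"
      using poly_eval.hom_add[of m "- m" x] by (simp add: m_def poly_eval_linear_form eq_neg_iff_add_eq_0 add.commute)
    \<comment> \<open>On the coordinates in \<open>I\<close>, x - m(x) p is the combination of the
      \<open>w i\<close> with coefficients x_i, hence in \<open>W\<close>.\<close>
    have "res (\<lambda>i. x i + poly_eval (- m) x * p i) = (\<Sum>i\<in>I. fscale (x i) (w i))"
    proof
      fix y
      have "(\<Sum>i\<in>I. fscale (x i) (w i)) y = (\<Sum>i\<in>I. x i * e i y) - (\<Sum>i\<in>I. s i * x i) * p y"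
        by (simp add: fun_sum_apply fscale_def[of "x _"] w right_diff_distrib sum_subtractf sum_distrib_left mult_ac)
      also have "(\<Sum>i\<in>I. x i * e i y) = (\<Sum>i\<in>I. if i = y then x i else 0)"
        by (intro sum.cong) (auto simp: e_def)
      also have "\<dots> = res x y" using \<open>finite I\<close> by (simp add: res_def)
      finally show "res (\<lambda>i. x i + poly_eval (- m) x * p i) y = (\<Sum>i\<in>I. fscale (x i) (w i)) y"
        using p(2) by (simp add: res_def m coord_space_def)
    qed
    also have "\<dots> \<in> W"
      using W(3) by (intro fun_space.subspace_sum fun_space.subspace_scale W(1)) (simp only: w_def)
    finally have "poly_eval f (\<lambda>i. x i + poly_eval (- m) x * p i) = 0" using W res by metis
    then show "poly_eval (poly L (- m)) x = poly_eval 0 x" by (simp add: L_def poly_eval_line_poly)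
  qed
  then have "[:m, 1:] dvd L" by (simp add: poly_eq_0_iff_dvd)
  then obtain q where q: "L = [:m, 1:] * q" by blast
  have "irreducible (fract_poly L)"
    unfolding L_def by (rule irreducible_fract_line_poly[OF form \<open>d > 0\<close> irr p(1)])
  moreover have "fract_poly L = fract_poly [:m, 1:] * fract_poly q" by (simp only: q fract_poly_mult)
  ultimately have "fract_poly [:m, 1:] dvd 1 \<or> fract_poly q dvd 1" using irreducibleD by blast
  moreover have "degree [:m, 1:] = 1" by simp
  moreover have "q \<noteq> 0" using q degL \<open>d > 0\<close> by auto
  \<comment> \<open>Irreducibility forces the cofactor of T + m to have degree 0, so
    \<open>L\<close> would have degree 1 instead of \<open>d\<close>.\<close>
  ultimately have "degree q = 0"
    by (auto simp: is_unit_iff_degree degree_map_poly simp del: degree_pCons_eq_if)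
  then show False using degL \<open>q \<noteq> 0\<close> \<open>d > 1\<close> degree_mult_eq[of "[:m, 1:]" q] by (simp add: q)
qed

theorem theorem1p9:
  fixes f :: "(nat, 'a::alg_closed_field) mpoly" and n d k r :: nat
  assumes "d > 1"
    and "is_form {0..n} d f"
    and "concise {0..n} f"
    and "irreducible f"
    and "covered_by_planes {0..n} (int k) (proj_zeros {0..n} f)"
  shows "(fano_split TYPE('a) 1 (int k) r d \<longrightarrow> product_rank {0..n} d f \<noteq> r) \<and>
         (even r \<and> int k > int n - int r \<and>
          (\<forall>t::nat. 2 * t + 4 \<le> r \<longrightarrow>
             fano_split TYPE('a) 2 (int k - int t * int d) (r - 2 * t) d)
          \<longrightarrow> product_rank {0..n} d f \<noteq> r)"
proof (intro conjI impI notI)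
  have gt1: "product_rank {0..n} d f > 1"
    using assms by (intro irreducible_form_product_rank_gt_1)
  have le: "product_rank {0..n} d f \<le> m"
    if "fano_split TYPE('a) m (int k) (product_rank {0..n} d f) d" "m \<ge> 1" for m
    using that assms by (intro product_rank_le_of_fano_split) auto
  {
    assume "fano_split TYPE('a) 1 (int k) r d" "product_rank {0..n} d f = r"
    then show False using le[of 1] gt1 by simp
  next
    assume *: "even r \<and> int k > int n - int r \<and>
          (\<forall>t::nat. 2 * t + 4 \<le> r \<longrightarrow>
             fano_split TYPE('a) 2 (int k - int t * int d) (r - 2 * t) d)"
      and r: "product_rank {0..n} d f = r"
    show False
    proof (cases "r \<ge> 4")
      case True
      \<comment> \<open>The case t = 0 concerns \<open>X_hyp r d\<close> itself and bounds the
        product rank by 2.\<close>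
      then have "fano_split TYPE('a) 2 (int k) r d" using * by (auto dest!: spec[of _ 0])
      then show False using le[of 2] r True by simp
    next
      case False
      then have "r = 2 \<or> r = 3" using gt1 r by auto
      then have "r = 2" using * by auto
      \<comment> \<open>For r = 2, k > n - 2 says that k + 2 is at least n + 1, the number of
        variables.\<close>
      then show False
        using assms * by (intro not_covered_by_hyperplanes[of "{0..n}" d f "int k"]) auto
    qed
  }
qed

end
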